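(* Let $r\ge1$ be an integer and let $S:\mathbb{R}^{r+1}\to\mathbb{R}$ be a local potential satisfying conditions A, B and C, with Peierls barrier $P_\omega(\xi)$. Let $\omega\in\mathbb{R}$ be Diophantine. Then, uniformly in $\xi$, the map $\omega\mapsto P_\omega(\xi)$ is locally Hölder continuous at $\omega$ with Hölder exponent $1/(2\tau)$: there is a constant $C>0$ such that, for any $\gamma>0$ and $\tau\ge1$ with $|p\omega-q|\ge\gamma/|p|^\tau$ for all integers $p\ne0$ and $q$, $$|P_\omega(\xi)-P_\Omega(\xi)|<\frac{5C}{\gamma^{1/\tau}}\,|\Omega-\omega|^{1/(2\tau)}$$ for all $\xi\in\mathbb{R}$ and all $\Omega\in\mathbb{R}$ with $0<|\Omega-\omega|\le1$.
   Context: Conditions on $S:\mathbb{R}^{r+1}\to\mathbb{R}$, written as $S(x_0,\dots,x_r)$: A (periodicity): $S(x_0+1,\dots,x_r+1)=S(x_0,\dots,x_r)$ for all arguments. B (monotonicity): $S$ is $C^2$, $\partial_i\partial_k S\le 0$ everywhere for all $i\ne k$, and $\partial_0\partial_1 S<0$ everywhere. C (coercivity): $S$ is bounded from below and there is $k\in\{0,\dots,r-1\}$ such that $S(x_0,\dots,x_r)\to\infty$ as $|x_{k+1}-x_k|\to\infty$. For $p,q\in\mathbb{Z}$ with $p\ge1$ let $\mathbb{X}_{p,q}$ be the set of sequences $x:\mathbb{Z}\to\mathbb{R}$ with $x_{i-p}+q=x_i$ for all $i$, and for $x\in\mathbb{X}_{p,q}$ let $W_{p,q}(x)=\sum_{j=0}^{p-1}S(x_j,\dots,x_{j+r})$.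 For a rational $q/p$ in lowest terms (with $p\ge1$) and $\xi\in\mathbb{R}$, the Peierls barrier is $$P_{q/p}(\xi)=\min_{x\in\mathbb{X}_{p,q},\,x_0=\xi}W_{p,q}(x)-\min_{x\in\mathbb{X}_{p,q}}W_{p,q}(x).$$ For irrational $\omega$, $P_\omega(\xi)=\lim_{q/p\to\omega}P_{q/p}(\xi)$, the limit being over rationals converging to $\omega$ (this limit exists). $\omega$ is Diophantine if there are $\gamma>0$ and $\tau\ge1$ with $|p\omega-q|\ge\gamma/|p|^\tau$ for all integers $p\ne0$ and $q$. *)

theory Defs
  imports "HOL-Analysis.Analysis"
begin

text \<open>
  A function on \<open>\<real>\<^sup>r\<^sup>+\<^sup>1\<close>, with \<open>r\<close> a natural number, is represented by a function
  of all sequences \<open>nat \<Rightarrow> real\<close> that depends on the coordinates \<open>0, \<dots>, r\<close> only. For such functions,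
  continuity in the product topology on \<open>nat \<Rightarrow> real\<close> is continuity on \<open>\<real>\<^sup>r\<^sup>+\<^sup>1\<close>.
\<close>

definition local_potential :: "nat \<Rightarrow> ((nat \<Rightarrow> real) \<Rightarrow> real) \<Rightarrow> bool" where
  "local_potential r S \<longleftrightarrow> (\<forall>x y. (\<forall>i\<le>r. x i = y i) \<longrightarrow> S x = S y)"

definition partial_deriv :: "nat \<Rightarrow> ((nat \<Rightarrow> real) \<Rightarrow> real) \<Rightarrow> (nat \<Rightarrow> real) \<Rightarrow> real" where
  "partial_deriv i f x = deriv (\<lambda>t. f (x(i := t))) (x i)"

definition C1 :: "nat \<Rightarrow> ((nat \<Rightarrow> real) \<Rightarrow> real) \<Rightarrow> bool" where
  "C1 r f \<longleftrightarrow>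
     continuous_on UNIV f \<and>
     (\<forall>i\<le>r. (\<forall>x. (\<lambda>t. f (x(i := t))) differentiable at (x i)) \<and>
            continuous_on UNIV (partial_deriv i f))"

definition C2 :: "nat \<Rightarrow> ((nat \<Rightarrow> real) \<Rightarrow> real) \<Rightarrow> bool" where
  "C2 r f \<longleftrightarrow> C1 r f \<and> (\<forall>i\<le>r. C1 r (partial_deriv i f))"

definition periodicity :: "((nat \<Rightarrow> real) \<Rightarrow> real) \<Rightarrow> bool" where
  "periodicity S \<longleftrightarrow> (\<forall>x. S (\<lambda>i. x i + 1) = S x)"

definition monotonicity :: "nat \<Rightarrow> ((nat \<Rightarrow> real) \<Rightarrow> real) \<Rightarrow> bool" where
  "monotonicity r S \<longleftrightarrow>
     C2 r S \<and>
     (\<forall>i\<le>r. \<forall>k\<le>r. i \<noteq> k \<longrightarrow> (\<forall>x. partial_deriv i (partial_deriv k S) x \<le> 0)) \<and>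
     (\<forall>x. partial_deriv 0 (partial_deriv 1 S) x < 0)"

definition coercivity :: "nat \<Rightarrow> ((nat \<Rightarrow> real) \<Rightarrow> real) \<Rightarrow> bool" where
  "coercivity r S \<longleftrightarrow>
     bdd_below (range S) \<and>
     (\<exists>k<r. filterlim S at_top (filtercomap (\<lambda>x. \<bar>x (k + 1) - x k\<bar>) at_top))"

definition periodic_seqs :: "int \<Rightarrow> int \<Rightarrow> (int \<Rightarrow> real) set" where
  "periodic_seqs p q = {x. \<forall>i. x (i - p) + of_int q = x i}"

definition periodic_action ::
    "((nat \<Rightarrow> real) \<Rightarrow> real) \<Rightarrow> int \<Rightarrow> (int \<Rightarrow> real) \<Rightarrow> real" where
  "periodic_action S p x = (\<Sum>j = 0..<p. S (\<lambda>i. x (j + int i)))"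

text \<open>
  \<open>quotient_of\<close> yields the numerator and the positive denominator of a rational number in lowest
  terms; the \<open>LEAST\<close> terms are the minima of the action (which are attained under the
  coercivity condition).
\<close>

definition peierls_barrier_rat :: "((nat \<Rightarrow> real) \<Rightarrow> real) \<Rightarrow> rat \<Rightarrow> real \<Rightarrow> real" where
  "peierls_barrier_rat S \<rho> \<xi> =
     (case quotient_of \<rho> of (q, p) \<Rightarrow>
        (LEAST w. w \<in> periodic_action S p ` {x \<in> periodic_seqs p q. x 0 = \<xi>}) -
        (LEAST w. w \<in> periodic_action S p ` periodic_seqs p q))"

definition peierls_barrier :: "((nat \<Rightarrow> real) \<Rightarrow> real) \<Rightarrow> real \<Rightarrow> real \<Rightarrow> real" where
  "peierls_barrier S \<omega> \<xi> =
     (if \<omega> \<in> \<rat> then peierls_barrier_rat S (THE \<rho>. real_of_rat \<rho> = \<omega>) \<xi>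
      else Lim (filtercomap real_of_rat (nhds \<omega>)) (\<lambda>\<rho>. peierls_barrier_rat S \<rho> \<xi>))"

definition diophantine_with :: "real \<Rightarrow> real \<Rightarrow> real \<Rightarrow> bool" where
  "diophantine_with \<gamma> \<tau> \<omega> \<longleftrightarrow>
     (\<forall>p q :: int. p \<noteq> 0 \<longrightarrow> \<bar>of_int p * \<omega> - of_int q\<bar> \<ge> \<gamma> / \<bar>of_int p\<bar> powr \<tau>)"

definition diophantine :: "real \<Rightarrow> bool" where
  "diophantine \<omega> \<longleftrightarrow> (\<exists>\<gamma> \<tau>. \<gamma> > 0 \<and> \<tau> \<ge> 1 \<and> diophantine_with \<gamma> \<tau> \<omega>)"

end

theory Submission
  imports Defs "HOL-Analysis.Kronecker_Approximation_Theorem"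
begin

text \<open>
  The key estimate compares the Peierls barriers of two rationals \<open>q/p\<close> and \<open>Q/P\<close> in a bounded range:
  they differ by at most \<open>C * \<epsilon>\<close> with \<open>\<epsilon> = 1/p + \<bar>p * Q/P - q\<bar>\<close>. By the sign of the mixed
  derivatives \<open>S\<close> is submodular, \<open>S (min x y) + S (max x y) \<le> S x + S y\<close>. This makes minimizers a lattice,
  hence yields Birkhoff minimizers, pinned Birkhoff minimizers and the
  convexity of the minimal action. For \<open>p < P\<close>, a Birkhoff sequence of type \<open>(P, Q)\<close> closes up after
  \<open>p\<close> steps to within \<open>O(\<epsilon>)\<close> at some place in every stretch of length \<open>p\<close>, so that one period of
  type \<open>(p, q)\<close> may be cut out of it, or inserted into it, at cost \<open>O(\<epsilon>)\<close>.

  The estimate extends to irrational \<open>\<omega>\<close> by passing to the limit. A Dirichlet approximation \<open>q/p\<close> of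
  \<open>\<omega>\<close> with \<open>p \<le> \<bar>\<Omega> - \<omega>\<bar> powr (-1/2)\<close>, whose denominator the Diophantine condition bounds from below,
  is then compared with both \<open>\<omega>\<close> and \<open>\<Omega>\<close>.
\<close>

subsection \<open>Submodularity and Lipschitz bounds\<close>

text \<open>The comparison must not see the long period \<open>P\<close>: an irrational number is
  approached with \<open>q / p\<close> fixed and \<open>P\<close> unbounded. Two facts about
  Birkhoff sequences provide this. Their increments are bounded in terms of the rotation number
  alone, so one Lipschitz constant of \<open>S\<close> serves a bounded range of rotation numbers,
  although \<open>S\<close> is only locally Lipschitz. And their total displacement after
  \<open>p\<close> steps, over any \<open>p\<close> consecutive indices, is at most
  \<open>2 * p * \<bar>p * \<rho> - q\<bar> + 1\<close>; averaging over the \<open>p\<close> places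
  gives the two summands of \<open>\<epsilon>\<close>. Closing up a stretch bounds its action only
  from below. The matching upper bound comes from the complementary stretch, of type
  \<open>(P - p, Q - q)\<close>, which is bounded from below in the same way, together with
  convexity. The exponent 1/2 is a balance: a Dirichlet bound \<open>N\<close> on \<open>p\<close>
  makes \<open>\<bar>p * \<omega> - q\<bar>\<close> of order \<open>1 / N\<close>, while
  \<open>p * \<bar>\<Omega> - \<omega>\<bar>\<close> may be as large as
  \<open>N * \<bar>\<Omega> - \<omega>\<bar>\<close>.\<close>

lemma local_potentialD: "local_potential r f \<Longrightarrow> (\<And>i. i \<le> r \<Longrightarrow> x i = y i) \<Longrightarrow> f x = f y"
  unfolding local_potential_def by blast

lemma local_potential_partial_deriv:
  assumes "local_potential r f" "k \<le> r"
  shows "local_potential r (partial_deriv k f)"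
  unfolding local_potential_def
proof (intro allI impI)
  fix x y :: "nat \<Rightarrow> real" assume xy: "\<forall>i\<le>r. x i = y i"
  have "(\<lambda>t. f (x(k := t))) = (\<lambda>t. f (y(k := t)))"
    by (intro ext local_potentialD[OF assms(1)]) (use xy in auto)
  with xy assms(2) show "partial_deriv k f x = partial_deriv k f y"
    unfolding partial_deriv_def by simp
qed

lemma C1_has_partial_deriv:
  assumes "C1 r f" "i \<le> r"
  shows "((\<lambda>t. f (x(i := t))) has_real_derivative partial_deriv i f (x(i := s))) (at s)"
proof -
  have "(\<lambda>t. f ((x(i := s))(i := t))) differentiable at ((x(i := s)) i)"
    using assms unfolding C1_def by blast
  then have "(\<lambda>t. f (x(i := t))) differentiable at s" by simp
  then have "((\<lambda>t. f (x(i := t))) has_real_derivative deriv (\<lambda>t. f (x(i := t))) s) (at s)"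
    using field_differentiable_derivI field_differentiable_def real_differentiableE by metis
  then show ?thesis unfolding partial_deriv_def by simp
qed

lemma antimono_coordinate_partial_deriv:
  assumes "C1 r f" "i \<le> r" and "\<And>x. partial_deriv i f x \<le> 0" and "s \<le> t"
  shows "f (x(i := t)) \<le> f (x(i := s))"
  by (rule DERIV_nonpos_imp_nonincreasing[OF assms(4), where f = "\<lambda>t. f (x(i := t))"])
    (use C1_has_partial_deriv[OF assms(1,2)] assms(3) in blast)

text \<open>The coordinates are moved from \<open>x\<close> to \<open>y\<close> one at a time, and
  coordinate \<open>k\<close> never moves. The exemption is made for
  \<open>f = partial_deriv k S\<close>, since the pure second derivative in direction
  \<open>k\<close> has no prescribed sign.\<close>

lemma antimono_off_coordinate:
  assumes loc: "local_potential r f"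
    and mono: "\<And>i x s t. i \<le> r \<Longrightarrow> i \<noteq> k \<Longrightarrow> s \<le> t \<Longrightarrow> f (x(i := t)) \<le> f (x(i := s))"
    and le: "\<And>i. x i \<le> y i" and eq: "x k = y k"
  shows "f y \<le> f x"
proof -
  define h where "h n = (\<lambda>i. if i < n then y i else x i)" for n :: nat
  have step: "n \<le> Suc r \<Longrightarrow> f (h n) \<le> f x" for n
  proof (induction n)
    case 0
    then show ?case by (simp add: h_def)
  next
    case (Suc n)
    have 1: "h (Suc n) = (h n)(n := y n)" by (auto simp: h_def)
    have 2: "h n = (h n)(n := x n)" by (auto simp: h_def)
    have "f (h (Suc n)) \<le> f (h n)"
    proof (cases "n = k")
      case True
      then have "h (Suc n) = h n" using 1 2 eq by metis
      then show ?thesis by simp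
    next
      case False
      then have "f ((h n)(n := y n)) \<le> f ((h n)(n := x n))"
        using mono Suc.prems le by simp
      then show ?thesis using 1 2 by metis
    qed
    with Suc show ?case by simp
  qed
  have "f (h (Suc r)) = f y" by (rule local_potentialD[OF loc]) (simp add: h_def)
  with step[of "Suc r"] show ?thesis by simp
qed

text \<open>As a function of the \<open>k\<close>-th coordinate, \<open>S\<close> at
  \<open>y\<close> minus \<open>S\<close> at \<open>x\<close> has derivative
  \<open>partial_deriv k S\<close> at \<open>y\<close> minus that at \<open>x\<close>, which is
  nonpositive because the mixed derivatives are.\<close>

lemma decreasing_differences:
  assumes loc: "local_potential r S" and mon: "monotonicity r S" and k: "k \<le> r"
    and le: "\<And>i. x i \<le> y i" and st: "s \<le> t"
  shows "S (y(k := t)) - S (y(k := s)) \<le> S (x(k := t)) - S (x(k := s))"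
proof -
  have C: "C1 r S" "C1 r (partial_deriv k S)"
    using mon k unfolding monotonicity_def C2_def by auto
  have le': "partial_deriv k S (y(k := u)) \<le> partial_deriv k S (x(k := u))" for u
  proof (rule antimono_off_coordinate[OF local_potential_partial_deriv[OF loc k], where k = k])
    fix i and x :: "nat \<Rightarrow> real" and s t :: real assume "i \<le> r" "i \<noteq> k" "s \<le> t"
    then show "partial_deriv k S (x(i := t)) \<le> partial_deriv k S (x(i := s))"
      using antimono_coordinate_partial_deriv[OF C(2)] mon k unfolding monotonicity_def by blast
  qed (use le in auto)
  have "S (y(k := t)) - S (x(k := t)) \<le> S (y(k := s)) - S (x(k := s))"
  proof (rule DERIV_nonpos_imp_nonincreasing[OF st, where f = "\<lambda>t. S (y(k := t)) - S (x(k := t))"])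
    fix u
    have "((\<lambda>t. S (y(k := t)) - S (x(k := t))) has_real_derivative
        partial_deriv k S (y(k := u)) - partial_deriv k S (x(k := u))) (at u)"
      by (intro DERIV_diff C1_has_partial_deriv[OF C(1) k])
    then show "\<exists>d. ((\<lambda>t. S (y(k := t)) - S (x(k := t))) has_real_derivative d) (at u) \<and> d \<le> 0"
      using le'[of u] by (intro exI conjI) auto
  qed
  then show ?thesis by simp
qed

lemma submodular:
  assumes loc: "local_potential r S" and mon: "monotonicity r S"
  shows "S (\<lambda>i. min (a i) (b i)) + S (\<lambda>i. max (a i) (b i)) \<le> S a + S b"
proof -
  \<comment> \<open>\<open>h\<close> climbs from the minimum to \<open>a\<close>, \<open>g\<close>
    from \<open>b\<close> to the maximum. Step \<open>n\<close> raises the same coordinate from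
    \<open>b n\<close> to \<open>a n\<close> in both (or moves neither), and \<open>h n\<close> lies
    below \<open>g n\<close>, so decreasing differences apply.\<close>
  define h where "h n = (\<lambda>i. if i < n then a i else min (a i) (b i))" for n :: nat
  define g where "g n = (\<lambda>i. if i < n then max (a i) (b i) else b i)" for n :: nat
  have step: "n \<le> Suc r \<Longrightarrow> S (g n) - S b \<le> S (h n) - S (\<lambda>i. min (a i) (b i))" for n
  proof (induction n)
    case 0
    then show ?case by (simp add: h_def g_def)
  next
    case (Suc n)
    have "S (g (Suc n)) - S (g n) \<le> S (h (Suc n)) - S (h n)"
    proof (cases "a n \<le> b n")
      case True
      then have "g (Suc n) = g n" "h (Suc n) = h n"
        by (auto simp: g_def h_def fun_eq_iff less_Suc_eq)
      then show ?thesis by simp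
    next
      case False
      have "g (Suc n) = (g n)(n := a n)" "h (Suc n) = (h n)(n := a n)"
        "g n = (g n)(n := b n)" "h n = (h n)(n := b n)"
        using False by (auto simp: g_def h_def fun_eq_iff less_Suc_eq)
      moreover have "S ((g n)(n := a n)) - S ((g n)(n := b n)) \<le> S ((h n)(n := a n)) - S ((h n)(n := b n))"
        by (rule decreasing_differences[OF loc mon]) (use Suc.prems False in \<open>auto simp: g_def h_def\<close>)
      ultimately show ?thesis by metis
    qed
    with Suc show ?case by simp
  qed
  have "S (h (Suc r)) = S a" "S (g (Suc r)) = S (\<lambda>i. max (a i) (b i))"
    by (rule local_potentialD[OF loc]; simp add: h_def g_def)+
  with step[of "Suc r"] show ?thesis by simp
qed

section \<open>Compactness of boxes and local Lipschitz bounds\<close>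

lemma compact_box: "compact {x :: 'a \<Rightarrow> real. \<forall>i. x i \<in> {l i..u i}}"
proof -
  have "compactin (product_topology (\<lambda>i. euclidean) UNIV) (PiE UNIV (\<lambda>i. {l i..u i}))"
    by (subst compactin_PiE) auto
  moreover have "PiE UNIV (\<lambda>i. {l i..u i}) = {x. \<forall>i. x i \<in> {l i..u i}}"
    by (auto simp: PiE_UNIV_domain)
  ultimately show ?thesis
    unfolding euclidean_product_topology by (simp only: compactin_euclidean_iff)
qed

lemma continuous_bounded_on_box:
  assumes "continuous_on UNIV (f :: (nat \<Rightarrow> real) \<Rightarrow> real)"
  obtains L where "L \<ge> 0" "\<And>x. (\<And>i. \<bar>x i\<bar> \<le> B) \<Longrightarrow> \<bar>f x\<bar> \<le> L"
proof -
  let ?K = "{x :: nat \<Rightarrow> real. \<forall>i. x i \<in> {-B..B}}"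
  have "compact (f ` ?K)"
    by (intro compact_continuous_image compact_box continuous_on_subset[OF assms]) auto
  then obtain L where "\<forall>y\<in>f ` ?K. norm y \<le> L" using compact_imp_bounded bounded_iff by metis
  moreover have "x \<in> ?K" if "\<And>i. \<bar>x i\<bar> \<le> B" for x
    using that by (auto simp: abs_le_iff minus_le_iff)
  ultimately have "\<bar>f x\<bar> \<le> max L 0" if "\<And>i. \<bar>x i\<bar> \<le> B" for x
    using that by (fastforce simp: le_max_iff_disj)
  then show ?thesis by (intro that[of "max L 0"]) auto
qed

lemma C1_lipschitz_on_box:
  assumes loc: "local_potential r S" and C: "C1 r S"
  obtains L where "L \<ge> 0"
    "\<And>a b D. (\<And>i. i \<le> r \<Longrightarrow> \<bar>a i\<bar> \<le> B) \<Longrightarrow> (\<And>i. i \<le> r \<Longrightarrow> \<bar>b i\<bar> \<le> B) \<Longrightarrow>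
      (\<And>i. i \<le> r \<Longrightarrow> \<bar>a i - b i\<bar> \<le> D) \<Longrightarrow> \<bar>S a - S b\<bar> \<le> L * D"
proof -
  have "\<exists>L. \<forall>i\<le>r. L i \<ge> 0 \<and> (\<forall>x. (\<forall>j. \<bar>x j\<bar> \<le> B) \<longrightarrow> \<bar>partial_deriv i S x\<bar> \<le> L i)"
  proof (rule choice, intro allI)
    fix i
    show "\<exists>L. i \<le> r \<longrightarrow> L \<ge> 0 \<and> (\<forall>x. (\<forall>j. \<bar>x j\<bar> \<le> B) \<longrightarrow> \<bar>partial_deriv i S x\<bar> \<le> L)"
    proof (cases "i \<le> r")
      case True
      then have "continuous_on UNIV (partial_deriv i S)" using C unfolding C1_def by blast
      then show ?thesis by (rule continuous_bounded_on_box[of _ B]) blast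
    qed auto
  qed
  then obtain L where L0: "\<And>i. i \<le> r \<Longrightarrow> L i \<ge> 0"
    and L: "\<And>i x. i \<le> r \<Longrightarrow> (\<And>j. \<bar>x j\<bar> \<le> B) \<Longrightarrow> \<bar>partial_deriv i S x\<bar> \<le> L i"
    by metis
  show ?thesis
  proof (rule that[of "\<Sum>i\<le>r. L i"])
    show "(\<Sum>i\<le>r. L i) \<ge> 0" by (intro sum_nonneg L0) auto
  next
    fix a b :: "nat \<Rightarrow> real" and D
    assume a: "\<And>i. i \<le> r \<Longrightarrow> \<bar>a i\<bar> \<le> B" and b: "\<And>i. i \<le> r \<Longrightarrow> \<bar>b i\<bar> \<le> B"
      and D: "\<And>i. i \<le> r \<Longrightarrow> \<bar>a i - b i\<bar> \<le> D"
    have B0: "B \<ge> 0" using a[of 0] by simp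
    \<comment> \<open>The derivative bounds hold where all coordinates are bounded by
      \<open>B\<close>, but \<open>a\<close> and \<open>b\<close> are controlled only up to index
      \<open>r\<close>; hence the value 0 beyond it.\<close>
    define h where "h n = (\<lambda>i. if i < n then a i else if i \<le> r then b i else 0)" for n :: nat
    have "n \<le> Suc r \<Longrightarrow> \<bar>S (h n) - S (h 0)\<bar> \<le> (\<Sum>i<n. L i * D)" for n
    proof (induction n)
      case 0
      then show ?case by simp
    next
      case (Suc n)
      then have nr: "n \<le> r" by simp
      have 1: "h (Suc n) = (h n)(n := a n)" "h n = (h n)(n := b n)"
        using nr by (auto simp: h_def fun_eq_iff less_Suc_eq)
      let ?I = "{min (a n) (b n)..max (a n) (b n)}"
      have "norm (S ((h n)(n := a n)) - S ((h n)(n := b n))) \<le> L n * norm (a n - b n)"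
      proof (rule field_differentiable_bound[where S = ?I and f' = "\<lambda>s. partial_deriv n S ((h n)(n := s))"])
        fix s assume s: "s \<in> ?I"
        show "((\<lambda>t. S ((h n)(n := t))) has_field_derivative partial_deriv n S ((h n)(n := s))) (at s within ?I)"
          using C1_has_partial_deriv[OF C nr] by (rule has_field_derivative_at_within)
        have "\<bar>s\<bar> \<le> B" using s a[OF nr] b[OF nr] by (auto simp: min_def max_def abs_le_iff split: if_splits)
        then show "norm (partial_deriv n S ((h n)(n := s))) \<le> L n"
          using a b nr B0 by (simp, intro L) (auto simp: h_def)
      qed auto
      also have "\<dots> \<le> L n * D" using D[OF nr] L0[OF nr] by (simp add: mult_left_mono)
      finally have "\<bar>S (h (Suc n)) - S (h n)\<bar> \<le> L n * D" using 1 by simp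
      then show ?case using Suc by simp
    qed
    from this[of "Suc r"] have "\<bar>S (h (Suc r)) - S (h 0)\<bar> \<le> (\<Sum>i\<le>r. L i) * D"
      by (simp add: sum_distrib_right lessThan_Suc_atMost)
    moreover have "S (h (Suc r)) = S a" "S (h 0) = S b"
      by (rule local_potentialD[OF loc]; simp add: h_def)+
    ultimately show "\<bar>S a - S b\<bar> \<le> (\<Sum>i\<le>r. L i) * D" by simp
  qed
qed

subsection \<open>Birkhoff sequences\<close>

lemma sum_periodic_window:
  fixes g :: "int \<Rightarrow> real"
  assumes per: "\<And>i. g (i + p) = g i" and p: "p \<ge> 0"
  shows "(\<Sum>j = m..<m + p. g j) = (\<Sum>j = 0..<p. g j)"
proof (induction m rule: int_induct[where k = 0])
  case base
  then show ?case by simp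
next
  case (step1 m)
  have "(\<Sum>j = m..<m + p. g j) = (\<Sum>j = m + 1..<m + 1 + p. g j)"
  proof (cases "p = 0")
    case False
    have "{m..<m + p} = insert m {m + 1..<m + p}" "{m + 1..<m + 1 + p} = insert (m + p) {m + 1..<m + p}"
      using p False by auto
    then show ?thesis using per[of m] by simp
  qed simp
  with step1 show ?case by simp
next
  case (step2 m)
  have "(\<Sum>j = m - 1..<m - 1 + p. g j) = (\<Sum>j = m..<m + p. g j)"
  proof (cases "p = 0")
    case False
    have "{m - 1..<m - 1 + p} = insert (m - 1) {m..<m - 1 + p}" "{m..<m + p} = insert (m - 1 + p) {m..<m - 1 + p}"
      using p False by auto
    then show ?thesis using per[of "m - 1"] by simp
  qed simp
  with step2 show ?case by simp
qed

lemma sum_int_shift: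
  fixes g :: "int \<Rightarrow> real"
  shows "(\<Sum>j = m + k..<n + k. g j) = (\<Sum>j = m..<n. g (j + k))"
  by (rule sum.reindex_bij_witness[where j = "\<lambda>j. j - k" and i = "\<lambda>j. j + k"]) auto

lemma sum_int_split:
  fixes g :: "int \<Rightarrow> real"
  assumes "l \<le> m" "m \<le> n"
  shows "(\<Sum>j = l..<n. g j) = (\<Sum>j = l..<m. g j) + (\<Sum>j = m..<n. g j)"
  using assms by (subst sum.union_disjoint[symmetric]) (auto intro!: sum.cong)

text \<open>Averaging: over \<open>p\<close> consecutive starting points the sums over windows of
  length \<open>r\<close> add up to at most \<open>r * A\<close>, so one of them is at most the
  mean.\<close>

lemma small_window_exists:
  fixes g :: "int \<Rightarrow> real"
  assumes p: "p \<ge> 1" and A: "\<And>s. (\<Sum>i = s..<s + p. g i) \<le> A"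
  obtains m where "m \<in> {s..<s + p}" "(\<Sum>k = m..<m + int r. g k) \<le> real r * A / of_int p"
proof -
  let ?h = "\<lambda>m. \<Sum>k = m..<m + int r. g k"
  have h: "?h m = (\<Sum>k = 0..<int r. g (m + k))" for m
    using sum_int_shift[of g 0 m "int r"] by (simp add: add.commute)
  have "(\<Sum>m = s..<s + p. ?h m) = (\<Sum>k = 0..<int r. \<Sum>m = s..<s + p. g (m + k))"
    unfolding h by (rule sum.swap)
  also have "\<dots> \<le> (\<Sum>k = 0..<int r. A)"
  proof (rule sum_mono)
    fix k
    show "(\<Sum>m = s..<s + p. g (m + k)) \<le> A"
      using A[of "s + k"] sum_int_shift[of g s k "s + p"] by (simp add: algebra_simps)
  qed
  finally have le: "(\<Sum>m = s..<s + p. ?h m) \<le> real r * A" by simp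
  show ?thesis
  proof (cases "\<exists>m\<in>{s..<s + p}. ?h m \<le> real r * A / of_int p")
    case True
    then show ?thesis using that by blast
  next
    case False
    then have "(\<Sum>m = s..<s + p. real r * A / of_int p) < (\<Sum>m = s..<s + p. ?h m)"
      using p by (intro sum_strict_mono) (auto simp: not_le)
    then show ?thesis using le p by simp
  qed
qed

text \<open>This bound stands in for compactness: up to an integer translation, which
  \<open>S\<close> does not notice, the windows of such sequences lie in a fixed box.\<close>

definition increments_le :: "real \<Rightarrow> (int \<Rightarrow> real) \<Rightarrow> bool" where
  "increments_le K x \<longleftrightarrow> (\<forall>i. \<bar>x (i + 1) - x i\<bar> \<le> K)"

lemma increments_leD: "increments_le K x \<Longrightarrow> \<bar>x (i + 1) - x i\<bar> \<le> K"
  unfolding increments_le_def by blast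

lemma increments_le_mono: "increments_le K x \<Longrightarrow> K \<le> K' \<Longrightarrow> increments_le K' x"
  unfolding increments_le_def by (meson order_trans)

lemma increments_le_nat:
  assumes "increments_le K x"
  shows "\<bar>x (i + int n) - x i\<bar> \<le> real n * K"
proof (induction n)
  case (Suc n)
  have "\<bar>x (i + int n + 1) - x (i + int n)\<bar> \<le> K" using assms by (rule increments_leD)
  with Suc show ?case by (simp add: algebra_simps)
qed simp

lemma increments_le_max:
  assumes "increments_le K x" "increments_le K y"
  shows "increments_le K (\<lambda>i. max (x i) (y i))"
  unfolding increments_le_def
proof
  fix i
  show "\<bar>max (x (i + 1)) (y (i + 1)) - max (x i) (y i)\<bar> \<le> K"
    using increments_leD[OF assms(1), of i] increments_leD[OF assms(2), of i] by (auto simp: max_def)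
qed

lemma increments_le_min:
  assumes "increments_le K x" "increments_le K y"
  shows "increments_le K (\<lambda>i. min (x i) (y i))"
  unfolding increments_le_def
proof
  fix i
  show "\<bar>min (x (i + 1)) (y (i + 1)) - min (x i) (y i)\<bar> \<le> K"
    using increments_leD[OF assms(1), of i] increments_leD[OF assms(2), of i] by (auto simp: min_def)
qed

section \<open>Sequences of type \<open>(p, q)\<close>\<close>

lemma periodic_seqsD: "x \<in> periodic_seqs p q \<Longrightarrow> x (i + p) = x i + of_int q"
  unfolding periodic_seqs_def by (auto dest: spec[of _ "i + p"])

lemma periodic_seqsI:
  assumes "\<And>i. x (i + p) = x i + of_int q"
  shows "x \<in> periodic_seqs p q"
proof -
  have "x (i - p) + of_int q = x i" for i
    using assms[of "i - p"] by (metis diff_add_cancel)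
  then show ?thesis unfolding periodic_seqs_def by blast
qed

lemma periodic_seqs_nat:
  assumes "x \<in> periodic_seqs p q"
  shows "x (i + int n * p) = x i + real n * of_int q"
proof (induction n)
  case (Suc n)
  have "x (i + int (Suc n) * p) = x (i + int n * p + p)" by (simp add: algebra_simps)
  with Suc periodic_seqsD[OF assms, of "i + int n * p"] show ?case by (simp add: algebra_simps)
qed simp

lemma periodic_seqs_int:
  assumes "x \<in> periodic_seqs p q"
  shows "x (i + n * p) = x i + of_int n * of_int q"
proof (cases "n \<ge> 0")
  case True
  then show ?thesis using periodic_seqs_nat[OF assms, of i "nat n"] by simp
next
  case False
  then show ?thesis using periodic_seqs_nat[OF assms, of "i + n * p" "nat (- n)"] by simp
qed

lemma periodic_seqs_shift:
  assumes "x \<in> periodic_seqs p q"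
  shows "(\<lambda>i. x (i + k) + c) \<in> periodic_seqs p q"
proof (rule periodic_seqsI)
  fix i
  have "i + p + k = i + k + p" "x (i + k) + of_int q + c = x (i + k) + c + of_int q" by simp_all
  then show "x (i + p + k) + c = x (i + k) + c + of_int q"
    using periodic_seqsD[OF assms, of "i + k"] by metis
qed

lemma periodic_seqs_max:
  assumes "x \<in> periodic_seqs p q" "y \<in> periodic_seqs p q"
  shows "(\<lambda>i. max (x i) (y i)) \<in> periodic_seqs p q"
proof (rule periodic_seqsI)
  fix i
  show "max (x (i + p)) (y (i + p)) = max (x i) (y i) + of_int q"
    by (subst periodic_seqsD[OF assms(1)], subst periodic_seqsD[OF assms(2)], simp only: max_add_distrib_left)
qed

lemma periodic_seqs_min:
  assumes "x \<in> periodic_seqs p q" "y \<in> periodic_seqs p q"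
  shows "(\<lambda>i. min (x i) (y i)) \<in> periodic_seqs p q"
proof (rule periodic_seqsI)
  fix i
  show "min (x (i + p)) (y (i + p)) = min (x i) (y i) + of_int q"
    by (subst periodic_seqsD[OF assms(1)], subst periodic_seqsD[OF assms(2)], simp only: min_add_distrib_left)
qed

text \<open>
  A sequence is Birkhoff of rotation number \<open>\<rho>\<close> when it is read off from a hull function: then
  any two of its translates \<open>\<lambda>i. y (i + k) + l\<close> are ordered like the numbers \<open>k * \<rho> + l\<close>.
\<close>

definition birkhoff :: "real \<Rightarrow> (int \<Rightarrow> real) \<Rightarrow> bool" where
  "birkhoff \<rho> y \<longleftrightarrow>
     (\<exists>Y :: real \<Rightarrow> real. mono Y \<and> (\<forall>t. Y (t + 1) = Y t + 1) \<and> (\<forall>i. y i = Y (of_int i * \<rho>)))"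

lemma hull_add_int:
  fixes Y :: "real \<Rightarrow> real"
  assumes "\<forall>t. Y (t + 1) = Y t + 1"
  shows "Y (t + of_int n) = Y t + of_int n"
proof -
  have nat: "Y (t + real n) = Y t + real n" for n t
  proof (induction n)
    case (Suc n)
    have "Y (t + real n + 1) = Y (t + real n) + 1" using assms by blast
    with Suc show ?case by (simp add: algebra_simps)
  qed simp
  show ?thesis
  proof (cases "n \<ge> 0")
    case True
    then show ?thesis using nat[of t "nat n"] by simp
  next
    case False
    then show ?thesis using nat[of "t + of_int n" "nat (- n)"] by simp
  qed
qed

lemma birkhoff_le:
  assumes "birkhoff \<rho> y" "of_int k * \<rho> + of_int l \<ge> 0"
  shows "y i \<le> y (i + k) + of_int l"
proof -
  obtain Y where Y: "mono Y" "\<forall>t. Y (t + 1) = Y t + 1" "\<And>i. y i = Y (of_int i * \<rho>)"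
    using assms(1) unfolding birkhoff_def by blast
  have "Y (of_int i * \<rho>) \<le> Y (of_int (i + k) * \<rho> + of_int l)"
    by (rule monoD[OF Y(1)]) (use assms(2) in \<open>simp add: algebra_simps\<close>)
  then show ?thesis using Y(3) hull_add_int[OF Y(2)] by simp
qed

lemma birkhoff_ge:
  assumes "birkhoff \<rho> y" "of_int k * \<rho> + of_int l \<le> 0"
  shows "y (i + k) + of_int l \<le> y i"
  using birkhoff_le[OF assms(1), of "- k" "- l" "i + k"] assms(2) by simp

lemma birkhoff_shift:
  assumes "birkhoff \<rho> y"
  shows "birkhoff \<rho> (\<lambda>i. y (i + k) + of_int l)"
proof -
  obtain Y where Y: "mono Y" "\<forall>t. Y (t + 1) = Y t + 1" "\<And>i. y i = Y (of_int i * \<rho>)"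
    using assms unfolding birkhoff_def by blast
  have "mono (\<lambda>t. Y (t + of_int k * \<rho>) + of_int l)"
    using Y(1) by (auto simp: mono_def)
  moreover have "\<forall>t. Y (t + 1 + of_int k * \<rho>) + of_int l = Y (t + of_int k * \<rho>) + of_int l + 1"
    using Y(2) by (metis add.assoc add.commute)
  moreover have "\<forall>i. y (i + k) + of_int l = Y (of_int i * \<rho> + of_int k * \<rho>) + of_int l"
    using Y(3) by (simp add: distrib_right)
  ultimately show ?thesis unfolding birkhoff_def by (intro exI[of _ "\<lambda>t. Y (t + of_int k * \<rho>) + of_int l"]) auto
qed

text \<open>The new hull function is \<open>- Y (- t)\<close>. The reflection reduces negative
  displacements to positive ones.\<close>

lemma birkhoff_minus:
  assumes "birkhoff \<rho> y"
  shows "birkhoff (- \<rho>) (\<lambda>i. - y i)"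
proof -
  obtain Y where Y: "mono Y" "\<forall>t. Y (t + 1) = Y t + 1" "\<And>i. y i = Y (of_int i * \<rho>)"
    using assms unfolding birkhoff_def by blast
  have "- Y (- (t + 1)) = - Y (- t) + 1" for t
    using Y(2)[rule_format, of "- (t + 1)"] by simp
  then show ?thesis unfolding birkhoff_def
    using Y(1,3) by (intro exI[of _ "\<lambda>t. - Y (- t)"]) (auto simp: mono_def)
qed

text \<open>One step of \<open>y\<close> is compared with the translations by the floor and the
  ceiling of \<open>\<rho>\<close>. The bound involves no period, so Lipschitz constants can be
  chosen uniformly.\<close>

lemma birkhoff_increments:
  assumes "birkhoff \<rho> y"
  shows "increments_le (\<bar>\<rho>\<bar> + 1) y"
  unfolding increments_le_def
proof
  fix i
  have "y i \<le> y (i + 1) + of_int (- \<lfloor>\<rho>\<rfloor>)" "y (i + 1) + of_int (- \<lceil>\<rho>\<rceil>) \<le> y i"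
    by (intro birkhoff_le[OF assms] birkhoff_ge[OF assms]; simp)+
  then show "\<bar>y (i + 1) - y i\<bar> \<le> \<bar>\<rho>\<bar> + 1" by (simp add: abs_if) linarith
qed

section \<open>Total displacement of a Birkhoff sequence\<close>

text \<open>Since \<open>q\<close> is prime to \<open>p\<close>, multiplication by \<open>q\<close>
  permutes the residues modulo \<open>p\<close>.\<close>

lemma sum_residues:
  fixes F :: "int \<Rightarrow> real"
  assumes p: "p \<ge> 1" and cop: "coprime p q" and per: "\<And>s. F (s + p) = F s"
  shows "(\<Sum>i = 0..<p. F (i * q)) = (\<Sum>s = 0..<p. F s)"
proof -
  have F: "F s = F (s mod p)" for s
  proof -
    have nat: "F (s + int n * p) = F s" for s n
    proof (induction n)
      case (Suc n)
      have "F (s + int (Suc n) * p) = F (s + int n * p + p)" by (simp add: algebra_simps)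
      with Suc show ?case by (simp add: per)
    qed simp
    have "F (s mod p + n * p) = F (s mod p)" for n
    proof (cases "n \<ge> 0")
      case True
      then show ?thesis using nat[of "s mod p" "nat n"] by simp
    next
      case False
      then show ?thesis using nat[of "s mod p + n * p" "nat (- n)"] by simp
    qed
    from this[of "s div p"] show ?thesis by (simp add: mod_div_decomp)
  qed
  have inj: "inj_on (\<lambda>i. (i * q) mod p) {0..<p}"
  proof (rule inj_onI)
    fix i j assume ij: "i \<in> {0..<p}" "j \<in> {0..<p}" "(i * q) mod p = (j * q) mod p"
    then have "p dvd (i - j) * q" by (simp add: mod_eq_dvd_iff left_diff_distrib)
    then have "p dvd i - j" using cop by (simp add: coprime_dvd_mult_left_iff)
    then have "i mod p = j mod p" by (simp add: mod_eq_dvd_iff)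
    then show "i = j" using ij by simp
  qed
  have "(\<lambda>i. (i * q) mod p) ` {0..<p} \<subseteq> {0..<p}" using p by auto
  then have im: "(\<lambda>i. (i * q) mod p) ` {0..<p} = {0..<p}"
    using inj by (simp add: endo_inj_surj)
  have "(\<Sum>s = 0..<p. F s) = (\<Sum>i = 0..<p. F ((i * q) mod p))"
    using sum.reindex[OF inj, of F] im by simp
  also have "\<dots> = (\<Sum>i = 0..<p. F (i * q))" using F by simp
  finally show ?thesis by simp
qed

text \<open>
  The intervals between \<open>y i\<close> and \<open>y (i + p) - q\<close>, for \<open>p\<close> consecutive indices, overlap at most
  about \<open>2 * p * \<delta>\<close> times: in the coordinate of the hull function they sit in
  \<open>[i * q / p, i * q / p + 2 * \<delta>]\<close>, and the sum of the increments of the hull function over these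
  intervals telescopes.
\<close>

lemma birkhoff_displacement_pos:
  assumes y: "birkhoff \<rho> y" and p: "p \<ge> 1" and cop: "coprime p q"
    and pos: "of_int p * \<rho> - of_int q \<ge> 0"
  shows "(\<Sum>i = 0..<p. \<bar>y (i + p) - of_int q - y i\<bar>) \<le> 2 * of_int p * (of_int p * \<rho> - of_int q) + 1"
proof -
  obtain Y where Y: "mono Y" "\<forall>t. Y (t + 1) = Y t + 1" "\<And>i. y i = Y (of_int i * \<rho>)"
    using y unfolding birkhoff_def by blast
  define \<delta> where "\<delta> = of_int p * \<rho> - of_int q"
  \<comment> \<open>The length \<open>2 * \<delta>\<close> is rounded up to whole steps of the grid
    \<open>1 / p\<close>: one \<open>\<delta>\<close> for the drift of \<open>i * \<rho>\<close>
    away from \<open>i * q / p\<close>, one for the displacement itself. The rounding is the source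
    of the \<open>+ 1\<close> in the bound.\<close>
  define h where "h = \<lceil>2 * of_int p * \<delta>\<rceil>"
  have d0: "\<delta> \<ge> 0" using pos by (simp add: \<delta>_def)
  have "0 \<le> 2 * of_int p * \<delta>" using d0 p by simp
  then have h0: "h \<ge> 0" unfolding h_def by (smt (verit) zero_le_ceiling)
  have hd: "2 * of_int p * \<delta> \<le> of_int h" unfolding h_def by simp
  have rho: "\<rho> = of_int q / of_int p + \<delta> / of_int p"
    using p by (simp add: \<delta>_def field_simps)
  have bound: "\<bar>y (i + p) - of_int q - y i\<bar> \<le> Y (of_int (i * q + h) / of_int p) - Y (of_int (i * q) / of_int p)"
    if i: "i \<in> {0..<p}" for i
  proof -
    have "y i \<le> y (i + p) + of_int (- q)"
      by (rule birkhoff_le[OF y]) (use pos in simp)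
    then have 1: "\<bar>y (i + p) - of_int q - y i\<bar> = y (i + p) + of_int (- q) - y i" by simp
    have i1: "of_int i * \<delta> / of_int p \<le> \<delta>" "of_int i * \<delta> / of_int p \<ge> 0"
      using i d0 p by (auto simp: divide_le_eq mult.commute[of \<delta>] intro!: mult_right_mono)
    have irho: "of_int i * \<rho> = of_int (i * q) / of_int p + of_int i * \<delta> / of_int p"
      using rho by (simp add: distrib_left)
    have "y (i + p) + of_int (- q) = Y (of_int i * \<rho> + \<delta>)"
      using Y(3) hull_add_int[OF Y(2), symmetric] by (simp add: \<delta>_def algebra_simps)
    also have "\<dots> \<le> Y (of_int (i * q + h) / of_int p)"
    proof (rule monoD[OF Y(1)])
      have "2 * \<delta> \<le> of_int h / of_int p" using hd p by (simp add: field_simps)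
      then show "of_int i * \<rho> + \<delta> \<le> of_int (i * q + h) / of_int p"
        using irho i1 by (simp add: add_divide_distrib)
    qed
    finally have 2: "y (i + p) + of_int (- q) \<le> Y (of_int (i * q + h) / of_int p)" .
    have "Y (of_int (i * q) / of_int p) \<le> y i"
      unfolding Y(3) by (rule monoD[OF Y(1)]) (use irho i1 in simp)
    with 1 2 show ?thesis by simp
  qed
  let ?F = "\<lambda>s. Y (of_int s / of_int p)"
  have F: "?F (s + p) = ?F s + 1" for s
    using Y(2) p by (simp add: add_divide_distrib)
  have "(\<Sum>i = 0..<p. \<bar>y (i + p) - of_int q - y i\<bar>) \<le> (\<Sum>i = 0..<p. ?F (i * q + h) - ?F (i * q))"
    by (rule sum_mono) (use bound in blast)
  also have "\<dots> = (\<Sum>s = 0..<p. ?F (s + h) - ?F s)"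
  proof (rule sum_residues[OF p cop, where F = "\<lambda>s. ?F (s + h) - ?F s"])
    fix s
    show "?F (s + p + h) - ?F (s + p) = ?F (s + h) - ?F s"
      using F[of s] F[of "s + h"] by (simp add: algebra_simps)
  qed
  also have "\<dots> = (\<Sum>s = 0 + h..<p + h. ?F s) - (\<Sum>s = 0..<p. ?F s)"
    by (simp only: sum_int_shift sum_subtractf)
  also have "\<dots> = (\<Sum>s = 0 + p..<h + p. ?F s) - (\<Sum>s = 0..<h. ?F s)"
    using sum_int_split[of 0 h "p + h" ?F] sum_int_split[of 0 p "h + p" ?F] h0 p by (simp add: add.commute)
  \<comment> \<open>Each of the \<open>h\<close> surviving terms spans a full period of the hull
    function and equals 1.\<close>
  also have "\<dots> = (\<Sum>s = 0..<h. ?F (s + p) - ?F s)"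
    by (simp only: sum_int_shift sum_subtractf)
  also have "\<dots> = of_int h" unfolding F using h0 by simp
  also have "\<dots> \<le> 2 * of_int p * \<delta> + 1" unfolding h_def by linarith
  finally show ?thesis by (simp add: \<delta>_def)
qed

lemma birkhoff_displacement:
  assumes y: "birkhoff \<rho> y" and p: "p \<ge> 1" and cop: "coprime p q"
  shows "(\<Sum>i = s..<s + p. \<bar>y (i + p) - of_int q - y i\<bar>) \<le> 2 * of_int p * \<bar>of_int p * \<rho> - of_int q\<bar> + 1"
proof -
  let ?x = "\<lambda>i. y (i + s)"
  have x: "birkhoff \<rho> ?x" using birkhoff_shift[OF y, of s 0] by simp
  have "(\<Sum>i = s..<s + p. \<bar>y (i + p) - of_int q - y i\<bar>) = (\<Sum>i = 0..<p. \<bar>?x (i + p) - of_int q - ?x i\<bar>)"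
    using sum_int_shift[of "\<lambda>i. \<bar>y (i + p) - of_int q - y i\<bar>" 0 s p] by (simp add: algebra_simps)
  also have "\<dots> \<le> 2 * of_int p * \<bar>of_int p * \<rho> - of_int q\<bar> + 1"
  proof (cases "of_int p * \<rho> - of_int q \<ge> 0")
    case True
    then show ?thesis using birkhoff_displacement_pos[OF x p cop] by simp
  next
    case False
    have "(\<Sum>i = 0..<p. \<bar>- ?x (i + p) - of_int (- q) - (- ?x i)\<bar>)
        \<le> 2 * of_int p * (of_int p * (- \<rho>) - of_int (- q)) + 1"
      by (rule birkhoff_displacement_pos[OF birkhoff_minus[OF x] p]) (use cop False in auto)
    moreover have "\<bar>- ?x (i + p) - of_int (- q) - (- ?x i)\<bar> = \<bar>?x (i + p) - of_int q - ?x i\<bar>" for i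
      by (simp add: abs_if)
    ultimately show ?thesis using False by simp
  qed
  finally show ?thesis .
qed

section \<open>Iterated translates and crossings\<close>

lemma iterated_translate_mono:
  fixes x :: "int \<Rightarrow> real"
  assumes le: "\<And>i. x i \<le> x (i + k) + of_int l" and mn: "m \<le> n"
  shows "x (i + m * k) + of_int (m * l) \<le> x (i + n * k) + of_int (n * l)"
  using mn
proof (induction n rule: int_ge_induct)
  case (step n)
  have "x (i + n * k) \<le> x (i + n * k + k) + of_int l" by (rule le)
  with step show ?case by (simp add: algebra_simps)
qed simp

text \<open>Another \<open>p\<close> iterations shift the index by \<open>k * p\<close>, which
  periodicity converts into the constant \<open>k * q\<close>.\<close>

lemma iterated_translate_period:
  assumes x: "x \<in> periodic_seqs p q"
  shows "x (i + (n + p) * k) + of_int ((n + p) * l) = x (i + n * k) + of_int (n * l) + of_int (k * q + l * p)"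
proof -
  have "x (i + (n + p) * k) = x (i + n * k + k * p)" by (simp add: algebra_simps)
  then show ?thesis unfolding periodic_seqs_int[OF x] by (simp add: algebra_simps)
qed

text \<open>
  The translate by \<open>(k, l)\<close> with \<open>k * q + l * p = 1\<close> generates all translates, so the ordered
  family of its iterates determines the hull function on the multiples of \<open>1 / p\<close>.
\<close>

lemma birkhoffI:
  assumes x: "x \<in> periodic_seqs p q" and p: "p \<ge> 1" and kl: "k * q + l * p = 1"
    and le: "\<And>i. x i \<le> x (i + k) + of_int l"
  shows "birkhoff (of_int q / of_int p) x"
proof -
  define f where "f n = x (n * k) + of_int (n * l)" for n :: int
  have fmono: "f m \<le> f n" if "m \<le> n" for m n
    using iterated_translate_mono[of x k l m n 0, OF le that] by (simp add: f_def)
  have fp: "f (n + p) = f n + 1" for n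
    using iterated_translate_period[OF x, of 0 n k l] unfolding kl by (simp add: f_def)
  \<comment> \<open>By the Bezout relation \<open>i * q * k\<close> equals \<open>i\<close> up to a
    multiple of \<open>p\<close>, so the iterates at index 0 recover every value of
    \<open>x\<close>.\<close>
  have fx: "f (i * q) = x i" for i
  proof -
    have "i * q * k = i * (k * q + l * p) + (- (i * l)) * p" by (simp add: algebra_simps)
    also have "\<dots> = i + (- (i * l)) * p" unfolding kl by simp
    finally show ?thesis
      unfolding f_def by (simp only: periodic_seqs_int[OF x]) (simp add: algebra_simps)
  qed
  define Y where "Y t = f \<lfloor>t * of_int p\<rfloor>" for t :: real
  have "mono Y" unfolding Y_def using p by (intro monoI fmono floor_mono mult_right_mono) auto
  moreover have "Y (t + 1) = Y t + 1" for t
    unfolding Y_def fp[symmetric] by (simp add: distrib_right floor_add_int[symmetric])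
  moreover have "x i = Y (of_int i * (of_int q / of_int p))" for i
  proof -
    have "of_int i * (of_int q / of_int p) * of_int p = (of_int (i * q) :: real)" using p by simp
    then show ?thesis unfolding Y_def by (simp only: floor_of_int fx)
  qed
  ultimately show ?thesis unfolding birkhoff_def by blast
qed

text \<open>An intermediate value argument without monotonicity: the drift puts \<open>f\<close> at
  or below \<open>\<xi>\<close> far to the left and above it far to the right, so some single step
  crosses.\<close>

lemma discrete_crossing:
  fixes f :: "int \<Rightarrow> real"
  assumes N: "N \<ge> 1" and c: "c > 0" and f: "\<And>n. f (n + N) = f n + c"
  obtains n where "f n \<le> \<xi>" "\<xi> \<le> f (n + 1)"
proof -
  have up: "f (n + int M * N) = f n + real M * c" for n M
  proof (induction M)
    case (Suc M)
    have "f (n + int (Suc M) * N) = f (n + int M * N + N)" by (simp add: algebra_simps)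
    with Suc f[of "n + int M * N"] show ?case by (simp add: distrib_right)
  qed simp
  obtain M1 where M1: "real M1 * c \<ge> \<bar>f 0 - \<xi>\<bar>" using c by (metis reals_Archimedean3 less_imp_le)
  \<comment> \<open>The \<open>+ 1\<close> makes \<open>f\<close> strictly exceed
    \<open>\<xi>\<close> at the right end, which is what the induction contradicts.\<close>
  obtain M2 where M2: "real M2 * c \<ge> \<bar>\<xi> - f 0\<bar> + 1" using c by (metis reals_Archimedean3 less_imp_le)
  let ?a = "- (int M1 * N)" and ?b = "int M2 * N"
  have a: "f ?a \<le> \<xi>" using up[of ?a M1] M1 by simp
  have b: "f ?b > \<xi>" using up[of 0 M2] M2 by simp
  have ab: "?a \<le> ?b" using N by (metis add.inverse_neutral mult_nonneg_nonneg neg_le_0_iff_le of_nat_0_le_iff order_trans zero_le_one)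
  show ?thesis
  proof (rule ccontr)
    assume "\<not> thesis"
    with that have no: "f n \<le> \<xi> \<Longrightarrow> f (n + 1) \<le> \<xi>" for n by (meson linear)
    have "f n \<le> \<xi>" if "?a \<le> n" for n
      using that by (induction n rule: int_ge_induct) (use a no in auto)
    from this[OF ab] b show False by simp
  qed
qed

text \<open>Meant for the drift \<open>p * Q - q * P\<close>, of which only the non-vanishing is
  known.\<close>

lemma discrete_crossing_signed:
  fixes f :: "int \<Rightarrow> real"
  assumes N: "N \<ge> 1" and c: "c \<noteq> 0" and f: "\<And>n. f (n + N) = f n + c"
  obtains n where "f n \<le> \<xi> \<and> \<xi> \<le> f (n + 1) \<or> f (n + 1) \<le> \<xi> \<and> \<xi> \<le> f n"
proof (cases "c > 0")
  case True
  then show ?thesis using discrete_crossing[where f = f, OF N True f, of \<xi>] that by blast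
next
  case False
  have "f (- (n + N)) = f (- n) + (- c)" for n
    using f[of "- n - N"] by simp
  then obtain n where "f (- n) \<le> \<xi>" "\<xi> \<le> f (- (n + 1))"
    using discrete_crossing[OF N, of "- c" "\<lambda>n. f (- n)" \<xi>] False c by auto
  then show ?thesis using that[of "- (n + 1)"] by simp
qed

subsection \<open>The action and its minimizers\<close>

text \<open>The windows starting before \<open>n\<close> also read the \<open>r\<close> entries from
  index \<open>n\<close> on. Every gluing cost below comes from these entries.\<close>

definition segment_action :: "((nat \<Rightarrow> real) \<Rightarrow> real) \<Rightarrow> int \<Rightarrow> int \<Rightarrow> (int \<Rightarrow> real) \<Rightarrow> real" where
  "segment_action S m n x = (\<Sum>j = m..<n. S (\<lambda>i. x (j + int i)))"

definition min_action :: "((nat \<Rightarrow> real) \<Rightarrow> real) \<Rightarrow> int \<Rightarrow> int \<Rightarrow> real" where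
  "min_action S p q = (LEAST w. w \<in> periodic_action S p ` periodic_seqs p q)"

definition pinned_action :: "((nat \<Rightarrow> real) \<Rightarrow> real) \<Rightarrow> int \<Rightarrow> int \<Rightarrow> real \<Rightarrow> real" where
  "pinned_action S p q \<xi> = (LEAST w. w \<in> periodic_action S p ` {x \<in> periodic_seqs p q. x 0 = \<xi>})"

text \<open>One constant for all positions and for all pairs of sequences with increments at most
  \<open>K\<close>, however far apart; unlike a box, this class is invariant under
  translations.\<close>

definition lipschitz_windows :: "nat \<Rightarrow> ((nat \<Rightarrow> real) \<Rightarrow> real) \<Rightarrow> real \<Rightarrow> real \<Rightarrow> bool" where
  "lipschitz_windows r S K L \<longleftrightarrow> L \<ge> 0 \<and>
     (\<forall>x y j D. increments_le K x \<longrightarrow> increments_le K y \<longrightarrow>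
        (\<forall>i\<le>r. \<bar>x (j + int i) - y (j + int i)\<bar> \<le> D) \<longrightarrow>
        \<bar>S (\<lambda>i. x (j + int i)) - S (\<lambda>i. y (j + int i))\<bar> \<le> L * D)"

lemma lipschitz_windowsD:
  "lipschitz_windows r S K L \<Longrightarrow> increments_le K x \<Longrightarrow> increments_le K y \<Longrightarrow>
    (\<And>i. i \<le> r \<Longrightarrow> \<bar>x (j + int i) - y (j + int i)\<bar> \<le> D) \<Longrightarrow>
    \<bar>S (\<lambda>i. x (j + int i)) - S (\<lambda>i. y (j + int i))\<bar> \<le> L * D"
  unfolding lipschitz_windows_def by blast

lemma periodic_action_eq: "periodic_action S p x = segment_action S 0 p x"
  by (simp add: periodic_action_def segment_action_def)

lemma segment_action_split:
  "l \<le> m \<Longrightarrow> m \<le> n \<Longrightarrow> segment_action S l n x = segment_action S l m x + segment_action S m n x"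
  unfolding segment_action_def by (rule sum_int_split)

lemma segment_action_shift:
  "segment_action S (m + k) (n + k) x = segment_action S m n (\<lambda>i. x (i + k))"
  unfolding segment_action_def sum_int_shift by (simp add: algebra_simps)

lemma segment_action_cong:
  assumes "\<And>i. m \<le> i \<Longrightarrow> x i = y i"
  shows "segment_action S m n x = segment_action S m n y"
  unfolding segment_action_def by (intro sum.cong refl arg_cong[where f = S] ext assms) auto

lemma periodic_seqs_increments:
  assumes x: "x \<in> periodic_seqs p q" and p: "p \<ge> 1"
  obtains K where "K \<ge> 0" "increments_le K x"
proof (rule that)
  let ?K = "\<Sum>i = 0..<p. \<bar>x (i + 1) - x i\<bar>"
  show "?K \<ge> 0" by (intro sum_nonneg) auto
  show "increments_le ?K x" unfolding increments_le_def
  proof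
    fix i
    let ?j = "i mod p" and ?n = "i div p"
    have i: "i = ?j + ?n * p" "i + 1 = (?j + 1) + ?n * p" by (simp_all add: mod_div_mult_eq)
    have "x i = x ?j + of_int ?n * of_int q" "x (i + 1) = x (?j + 1) + of_int ?n * of_int q"
      using periodic_seqs_int[OF x, of ?j ?n] periodic_seqs_int[OF x, of "?j + 1" ?n] i by metis+
    then have "\<bar>x (i + 1) - x i\<bar> = \<bar>x (?j + 1) - x ?j\<bar>" by simp
    also have "\<dots> \<le> ?K" using p by (intro member_le_sum[where f = "\<lambda>i. \<bar>x (i + 1) - x i\<bar>"]) auto
    finally show "\<bar>x (i + 1) - x i\<bar> \<le> ?K" .
  qed
qed

locale monotone_potential =
  fixes r :: nat and S :: "(nat \<Rightarrow> real) \<Rightarrow> real"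
  assumes r: "r \<ge> 1" and loc: "local_potential r S" and periodic: "periodicity S"
    and mon: "monotonicity r S" and coer: "coercivity r S"
begin

abbreviation "W \<equiv> periodic_action S"
abbreviation "seg \<equiv> segment_action S"
abbreviation "lip \<equiv> lipschitz_windows r S"
abbreviation "mn \<equiv> min_action S"
abbreviation "pn \<equiv> pinned_action S"

lemma C1_S: "C1 r S"
  using mon unfolding monotonicity_def C2_def by blast

lemma potential_add_int: "S (\<lambda>i. a i + of_int n) = S a"
proof -
  have nat: "S (\<lambda>i. a i + real n) = S a" for n a
  proof (induction n)
    case (Suc n)
    have "S (\<lambda>i. a i + real (Suc n)) = S (\<lambda>i. (a i + real n) + 1)" by (simp add: add_ac)
    with Suc periodic show ?case by (simp add: periodicity_def)
  qed simp
  show ?thesis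
  proof (cases "n \<ge> 0")
    case True
    then show ?thesis using nat[of a "nat n"] by simp
  next
    case False
    then show ?thesis using nat[of "\<lambda>i. a i + of_int n" "nat (- n)"] by simp
  qed
qed

lemma seg_add_int: "seg m n (\<lambda>i. x i + of_int l) = seg m n x"
  unfolding segment_action_def using potential_add_int by simp

lemma seg_periodic:
  assumes "x \<in> periodic_seqs p q" "p \<ge> 1"
  shows "seg m (m + p) x = W p x"
  unfolding segment_action_def periodic_action_def
proof (rule sum_periodic_window)
  fix j
  have "(\<lambda>i. x (j + p + int i)) = (\<lambda>i. x (j + int i) + of_int q)"
    using periodic_seqsD[OF assms(1), of "j + int i" for i] by (simp add: add_ac)
  then show "S (\<lambda>i. x (j + p + int i)) = S (\<lambda>i. x (j + int i))" using potential_add_int by metis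
qed (use assms in simp)

lemma W_translate:
  assumes "x \<in> periodic_seqs p q" "p \<ge> 1"
  shows "W p (\<lambda>i. x (i + k) + of_int l) = W p x"
proof -
  have "W p (\<lambda>i. x (i + k) + of_int l) = seg (0 + k) (p + k) x"
    unfolding periodic_action_eq seg_add_int segment_action_shift ..
  then show ?thesis using seg_periodic[OF assms, of k] by (simp add: add.commute)
qed

lemma seg_submodular:
  "seg m n (\<lambda>i. min (x i) (y i)) + seg m n (\<lambda>i. max (x i) (y i)) \<le> seg m n x + seg m n y"
  unfolding segment_action_def sum.distrib[symmetric]
  by (intro sum_mono submodular[OF loc mon])

text \<open>Subtracting the integer part of \<open>x j\<close> moves the window into a box. For
  \<open>D \<le> 1\<close> the Lipschitz bound on the box applies; for larger \<open>D\<close> the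
  bound \<open>C\<close> on the values of \<open>S\<close> suffices, whence the constant
  \<open>L + 2 * C\<close>.\<close>

lemma lipschitz_windows_exists:
  assumes K: "K \<ge> 0"
  obtains L where "lip K L"
proof -
  \<comment> \<open>The spread of a window is at most \<open>real r * K\<close>; one unit more is
    for the fractional part of \<open>x j\<close>, the other for the distance
    \<open>D \<le> 1\<close> of the second window.\<close>
  define B where "B = real r * K + 2"
  obtain L where L0: "L \<ge> 0" and L: "\<And>a b D. (\<And>i. i \<le> r \<Longrightarrow> \<bar>a i\<bar> \<le> B) \<Longrightarrow> (\<And>i. i \<le> r \<Longrightarrow> \<bar>b i\<bar> \<le> B) \<Longrightarrow>
      (\<And>i. i \<le> r \<Longrightarrow> \<bar>a i - b i\<bar> \<le> D) \<Longrightarrow> \<bar>S a - S b\<bar> \<le> L * D"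
    using C1_lipschitz_on_box[OF loc C1_S, of B] by metis
  have B0: "B \<ge> 0" using K by (simp add: B_def)
  define C where "C = \<bar>S (\<lambda>_. 0)\<bar> + L * B"
  have C0: "C \<ge> 0" using L0 B0 by (simp add: C_def)
  have box: "\<bar>x (j + int i) + of_int (- \<lfloor>x j\<rfloor>)\<bar> \<le> B - 1" if "increments_le K x" "i \<le> r" for x i j
  proof -
    have "\<bar>x (j + int i) - x j\<bar> \<le> real i * K" using that increments_le_nat by blast
    also have "\<dots> \<le> real r * K" using that K by (intro mult_right_mono) auto
    finally show ?thesis unfolding B_def by (simp add: abs_le_iff) linarith
  qed
  have bound: "\<bar>S (\<lambda>i. x (j + int i))\<bar> \<le> C" if "increments_le K x" for x j
  proof -
    have "\<bar>S (\<lambda>i. x (j + int i) + of_int (- \<lfloor>x j\<rfloor>)) - S (\<lambda>_. 0)\<bar> \<le> L * B"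
    proof (rule L)
      fix i assume "i \<le> r"
      then have "\<bar>x (j + int i) + of_int (- \<lfloor>x j\<rfloor>)\<bar> \<le> B" using box[OF that, of i j] by linarith
      then show "\<bar>x (j + int i) + of_int (- \<lfloor>x j\<rfloor>)\<bar> \<le> B"
        "\<bar>x (j + int i) + of_int (- \<lfloor>x j\<rfloor>) - 0\<bar> \<le> B" by simp_all
    qed (use B0 in simp)
    then show ?thesis unfolding potential_add_int C_def by simp
  qed
  have "\<bar>S (\<lambda>i. x (j + int i)) - S (\<lambda>i. y (j + int i))\<bar> \<le> (L + 2 * C) * D"
    if x: "increments_le K x" and y: "increments_le K y"
      and D: "\<forall>i\<le>r. \<bar>x (j + int i) - y (j + int i)\<bar> \<le> D" for x y j D
  proof -
    have D0: "D \<ge> 0" using D by (meson abs_ge_zero le0 order_trans)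
    show ?thesis
    proof (cases "D \<le> 1")
      case True
      have "\<bar>S (\<lambda>i. x (j + int i) + of_int (- \<lfloor>x j\<rfloor>)) - S (\<lambda>i. y (j + int i) + of_int (- \<lfloor>x j\<rfloor>))\<bar> \<le> L * D"
      proof (rule L)
        fix i assume i: "i \<le> r"
        show "\<bar>x (j + int i) + of_int (- \<lfloor>x j\<rfloor>)\<bar> \<le> B" using box[OF x i, of j] by simp
        have "\<bar>x (j + int i) - y (j + int i)\<bar> \<le> 1" using D i True by force
        then show "\<bar>y (j + int i) + of_int (- \<lfloor>x j\<rfloor>)\<bar> \<le> B" using box[OF x i, of j] by linarith
        show "\<bar>x (j + int i) + of_int (- \<lfloor>x j\<rfloor>) - (y (j + int i) + of_int (- \<lfloor>x j\<rfloor>))\<bar> \<le> D"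
          using D i by simp
      qed
      also have "\<dots> \<le> (L + 2 * C) * D" using C0 D0 by (simp add: distrib_right)
      finally show ?thesis unfolding potential_add_int .
    next
      case False
      have "\<bar>S (\<lambda>i. x (j + int i)) - S (\<lambda>i. y (j + int i))\<bar> \<le> 2 * C"
        using bound[OF x, of j] bound[OF y, of j] by linarith
      also have "\<dots> \<le> 2 * C * D" using False C0 by (simp add: mult_le_cancel_left1)
      also have "\<dots> \<le> (L + 2 * C) * D" using L0 D0 by (simp add: distrib_right)
      finally show ?thesis .
    qed
  qed
  then show ?thesis using L0 C0 by (intro that[of "L + 2 * C"]) (simp add: lipschitz_windows_def)
qed

section \<open>Existence of minimizers\<close>

lemma continuous_W: "continuous_on UNIV (W p)"
proof -
  have S: "continuous_on UNIV S" using C1_S by (simp add: C1_def)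
  have "continuous_on UNIV (\<lambda>x. S (\<lambda>i. x (j + int i)))" for j
    by (rule continuous_on_compose2[OF S])
      (auto intro!: continuous_on_coordinatewise_then_product continuous_on_product_coordinates)
  then show ?thesis
    unfolding periodic_action_def[abs_def] by (intro continuous_on_sum) blast
qed

lemma closed_periodic_seqs: "closed (periodic_seqs p q)"
  unfolding periodic_seqs_def
  by (intro closed_Collect_all closed_Collect_eq continuous_on_add continuous_on_const
      continuous_on_product_coordinates)

text \<open>Coercivity controls the difference at position \<open>k\<close> of each window. As the
  windows range over one period, these differences exhaust all increments up to periodicity.\<close>

lemma sublevel_increments:
  assumes p: "p \<ge> 1"
  obtains B where "B \<ge> 0" "\<And>y. y \<in> periodic_seqs p q \<Longrightarrow> W p y \<le> w \<Longrightarrow> increments_le B y"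
proof -
  obtain s where s: "\<And>a. s \<le> S a"
    using coer unfolding coercivity_def bdd_below_def by blast
  obtain k where k: "filterlim S at_top (filtercomap (\<lambda>x. \<bar>x (k + 1) - x k\<bar>) at_top)"
    using coer unfolding coercivity_def by blast
  \<comment> \<open>The other \<open>p - 1\<close> windows contribute at least \<open>s\<close>
    each; the threshold is the value which, added to these, exceeds \<open>w\<close> by 1.\<close>
  have "eventually (\<lambda>a. w - (of_int p - 1) * s + 1 \<le> S a) (filtercomap (\<lambda>x. \<bar>x (k + 1) - x k\<bar>) at_top)"
    using k unfolding filterlim_at_top by blast
  then obtain B where B: "\<And>a. B \<le> \<bar>a (k + 1) - a k\<bar> \<Longrightarrow> w - (of_int p - 1) * s + 1 \<le> S a"
    unfolding eventually_filtercomap eventually_at_top_linorder by blast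
  show ?thesis
  proof (rule that[of "max B 0"])
    fix y assume y: "y \<in> periodic_seqs p q" and yw: "W p y \<le> w"
    have bd: "\<bar>y (j + int k + 1) - y (j + int k)\<bar> \<le> B" if j: "j \<in> {0..<p}" for j
    proof (rule ccontr)
      assume "\<not> ?thesis"
      then have "w - (of_int p - 1) * s + 1 \<le> S (\<lambda>i. y (j + int i))"
        by (intro B) (simp add: add_ac)
      moreover have "W p y = S (\<lambda>i. y (j + int i)) + (\<Sum>l\<in>{0..<p} - {j}. S (\<lambda>i. y (l + int i)))"
        unfolding periodic_action_def using j by (intro sum.remove) auto
      moreover have "(\<Sum>l\<in>{0..<p} - {j}. S (\<lambda>i. y (l + int i))) \<ge> (\<Sum>l\<in>{0..<p} - {j}. s)"
        by (intro sum_mono s)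
      moreover have "(\<Sum>l\<in>{0..<p} - {j}. s) = (of_int p - 1) * s"
      proof -
        have "card ({0..<p} - {j}) = nat p - 1" using j by (simp add: card_Diff_singleton)
        moreover have "nat p \<ge> 1" using p by simp
        ultimately have "real (card ({0..<p} - {j})) = of_int p - 1" using p by (simp add: of_nat_diff)
        then show ?thesis by simp
      qed
      ultimately show False using yw by simp
    qed
    show "increments_le (max B 0) y" unfolding increments_le_def
    proof
      fix i
      let ?j = "(i - int k) mod p" and ?n = "(i - int k) div p"
      have "i - int k = ?j + ?n * p" by (simp add: mod_div_mult_eq)
      then have i: "i = (?j + int k) + ?n * p" "i + 1 = (?j + int k + 1) + ?n * p" by simp_all
      have "y i = y (?j + int k) + of_int ?n * of_int q" "y (i + 1) = y (?j + int k + 1) + of_int ?n * of_int q"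
        using periodic_seqs_int[OF y, of "?j + int k" ?n] periodic_seqs_int[OF y, of "?j + int k + 1" ?n] i by metis+
      then have "\<bar>y (i + 1) - y i\<bar> = \<bar>y (?j + int k + 1) - y (?j + int k)\<bar>" by simp
      also have "\<dots> \<le> B" by (rule bd) (use p in auto)
      finally show "\<bar>y (i + 1) - y i\<bar> \<le> max B 0" by simp
    qed
  qed simp
qed

text \<open>The direct method, for free and pinned minimizers at once: \<open>I\<close> is
  \<open>{0..1}\<close> for the former and \<open>{\<xi>}\<close> for the latter. The straight line
  \<open>z\<close> fixes a sublevel set, whose bounded increments confine it to a box growing
  linearly in the index.\<close>

lemma minimizer_exists:
  assumes p: "p \<ge> 1" and I: "compact I" "I \<noteq> {}"
  obtains x where "x \<in> periodic_seqs p q" "x 0 \<in> I"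
    "\<And>y. y \<in> periodic_seqs p q \<Longrightarrow> y 0 \<in> I \<Longrightarrow> W p x \<le> W p y"
proof -
  obtain \<xi> where \<xi>: "\<xi> \<in> I" using I by blast
  define z where "z i = \<xi> + of_int i * of_int q / of_int p" for i :: int
  have z: "z \<in> periodic_seqs p q"
    by (rule periodic_seqsI) (use p in \<open>simp add: z_def field_simps\<close>)
  have z0: "z 0 \<in> I" using \<xi> by (simp add: z_def)
  obtain B where B: "B \<ge> 0" "\<And>y. y \<in> periodic_seqs p q \<Longrightarrow> W p y \<le> W p z \<Longrightarrow> increments_le B y"
    using sublevel_increments[OF p] by metis
  obtain c where c: "\<And>t. t \<in> I \<Longrightarrow> \<bar>t\<bar> \<le> c"
    using compact_imp_bounded[OF I(1)] unfolding bounded_iff by auto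
  define E where "E = {y :: int \<Rightarrow> real. \<forall>i. y i \<in> {- c - \<bar>of_int i\<bar> * B..c + \<bar>of_int i\<bar> * B}}
      \<inter> ((\<lambda>y. y 0) -` I \<inter> periodic_seqs p q)"
  have E: "y \<in> E" if y: "y \<in> periodic_seqs p q" "y 0 \<in> I" "W p y \<le> W p z" for y
  proof -
    note inc = B(2)[OF y(1,3)]
    have "\<bar>y i - y 0\<bar> \<le> \<bar>of_int i\<bar> * B" for i
    proof (cases "i \<ge> 0")
      case True
      then show ?thesis using increments_le_nat[OF inc, of 0 "nat i"] by simp
    next
      case False
      then show ?thesis using increments_le_nat[OF inc, of i "nat (- i)"] by (simp add: abs_minus_commute)
    qed
    then have "y i \<in> {- c - \<bar>of_int i\<bar> * B..c + \<bar>of_int i\<bar> * B}" for i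
      using c[OF y(2)] by (smt (verit) atLeastAtMost_iff)
    then show ?thesis using y by (simp add: E_def)
  qed
  have "closed ((\<lambda>y :: int \<Rightarrow> real. y 0) -` I)"
    by (intro closed_vimage compact_imp_closed I continuous_on_product_coordinates)
  then have "compact E" unfolding E_def
    by (intro compact_Int_closed compact_box closed_Int closed_periodic_seqs)
  moreover have zE: "z \<in> E" using E z z0 by blast
  ultimately obtain x where x: "x \<in> E" "\<And>y. y \<in> E \<Longrightarrow> W p x \<le> W p y"
    using continuous_attains_inf[of E "W p"] continuous_on_subset[OF continuous_W] by blast
  show ?thesis
  proof (rule that)
    show "x \<in> periodic_seqs p q" "x 0 \<in> I" using x(1) by (auto simp: E_def)
    fix y assume "y \<in> periodic_seqs p q" "y 0 \<in> I"
    then show "W p x \<le> W p y" using x(2)[of y] x(2)[OF zE] E[of y] by fastforce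
  qed
qed

definition minimizers :: "int \<Rightarrow> int \<Rightarrow> (int \<Rightarrow> real) set" where
  "minimizers p q = {x \<in> periodic_seqs p q. W p x = mn p q}"

lemma minimizersD: "x \<in> minimizers p q \<Longrightarrow> x \<in> periodic_seqs p q" "x \<in> minimizers p q \<Longrightarrow> W p x = mn p q"
  by (auto simp: minimizers_def)

lemma min_action_facts:
  assumes p: "p \<ge> 1"
  shows "minimizers p q \<noteq> {}" and "y \<in> periodic_seqs p q \<Longrightarrow> mn p q \<le> W p y"
proof -
  obtain x where x: "x \<in> periodic_seqs p q"
    "\<And>y. y \<in> periodic_seqs p q \<Longrightarrow> y 0 \<in> {0..1} \<Longrightarrow> W p x \<le> W p y"
    by (rule minimizer_exists[OF p, of "{0..1}" q]) auto
  have le: "W p x \<le> W p y" if y: "y \<in> periodic_seqs p q" for y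
  proof -
    \<comment> \<open>An integer translation brings \<open>y 0\<close> into the unit interval and
      preserves the action, so the compact constraint loses nothing.\<close>
    have "W p x \<le> W p (\<lambda>i. y (i + 0) + of_int (- \<lfloor>y 0\<rfloor>))"
      by (rule x(2)[OF periodic_seqs_shift[OF y]]) (simp add: less_imp_le, linarith)
    then show ?thesis unfolding W_translate[OF y p] .
  qed
  have "mn p q = W p x" unfolding min_action_def
    by (rule Least_equality) (use x(1) le in auto)
  then show "minimizers p q \<noteq> {}" "y \<in> periodic_seqs p q \<Longrightarrow> mn p q \<le> W p y"
    using x(1) le by (auto simp: minimizers_def)
qed

lemma pinned_action_facts:
  assumes p: "p \<ge> 1"
  shows "\<exists>x \<in> periodic_seqs p q. x 0 = \<xi> \<and> W p x = pn p q \<xi>"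
    and "y \<in> periodic_seqs p q \<Longrightarrow> y 0 = \<xi> \<Longrightarrow> pn p q \<xi> \<le> W p y"
proof -
  obtain x where x: "x \<in> periodic_seqs p q" "x 0 = \<xi>"
    "\<And>y. y \<in> periodic_seqs p q \<Longrightarrow> y 0 = \<xi> \<Longrightarrow> W p x \<le> W p y"
    by (rule minimizer_exists[OF p, of "{\<xi>}" q]) auto
  have "pn p q \<xi> = W p x" unfolding pinned_action_def
    by (rule Least_equality) (use x in auto)
  then show "\<exists>x \<in> periodic_seqs p q. x 0 = \<xi> \<and> W p x = pn p q \<xi>"
    "y \<in> periodic_seqs p q \<Longrightarrow> y 0 = \<xi> \<Longrightarrow> pn p q \<xi> \<le> W p y"
    using x by auto
qed

section \<open>Order structure of the minimizers\<close>

lemma min_le_pinned: "p \<ge> 1 \<Longrightarrow> mn p q \<le> pn p q \<xi>"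
  using pinned_action_facts(1)[of p q \<xi>] min_action_facts(2)[of p] by force

lemma minimizers_translate:
  "p \<ge> 1 \<Longrightarrow> x \<in> minimizers p q \<Longrightarrow> (\<lambda>i. x (i + k) + of_int l) \<in> minimizers p q"
  using periodic_seqs_shift[of x p q k "of_int l"] W_translate[of x p q k l] by (simp add: minimizers_def)

text \<open>Minimum and maximum each have action at least \<open>mn p q\<close>, and by
  submodularity together at most twice that, so both minimize.\<close>

lemma minimizers_max:
  assumes p: "p \<ge> 1" and xy: "x \<in> minimizers p q" "y \<in> minimizers p q"
  shows "(\<lambda>i. max (x i) (y i)) \<in> minimizers p q"
proof -
  note per = xy[THEN minimizersD(1)]
  have "mn p q \<le> W p (\<lambda>i. min (x i) (y i))" "mn p q \<le> W p (\<lambda>i. max (x i) (y i))"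
    by (intro min_action_facts(2)[OF p] periodic_seqs_min periodic_seqs_max per)+
  moreover have "W p (\<lambda>i. min (x i) (y i)) + W p (\<lambda>i. max (x i) (y i)) \<le> mn p q + mn p q"
    using seg_submodular[of 0 p x y] xy by (simp add: periodic_action_eq minimizers_def)
  ultimately show ?thesis using periodic_seqs_max[OF per] by (simp add: minimizers_def)
qed

lemma minimizers_Max:
  assumes p: "p \<ge> 1" and J: "finite J" "J \<noteq> {}" and f: "\<And>j. j \<in> J \<Longrightarrow> f j \<in> minimizers p q"
  shows "(\<lambda>i. Max ((\<lambda>j. f j i) ` J)) \<in> minimizers p q"
  using J f
proof (induction J rule: finite_ne_induct)
  case (insert j J)
  have "(\<lambda>i. Max ((\<lambda>j. f j i) ` insert j J)) = (\<lambda>i. max (f j i) (Max ((\<lambda>j. f j i) ` J)))"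
    using insert by (simp add: Max_insert)
  then show ?case using minimizers_max[OF p, of "f j"] insert by simp
qed simp

text \<open>
  The maximum of the first \<open>p\<close> backward translates of a minimizer only decreases under one more
  backward translation, because the \<open>p\<close>-th one is at most the original minimizer.
\<close>

lemma monotone_minimizer_exists:
  assumes p: "p \<ge> 1" and kl: "k * q + l * p \<ge> 0"
  obtains z where "z \<in> minimizers p q" "\<And>i. z i \<le> z (i + k) + of_int l"
proof -
  obtain x where x: "x \<in> minimizers p q" using min_action_facts(1)[OF p] by blast
  define f where "f j i = x (i + (- j * k)) + of_int (- j * l)" for j i :: int
  define z where "z i = Max ((\<lambda>j. f j i) ` {0..<p})" for i
  have "z \<in> minimizers p q"
    unfolding z_def[abs_def]
  proof (rule minimizers_Max[OF p])
    show "f j \<in> minimizers p q" for j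
      unfolding f_def[abs_def] by (rule minimizers_translate[OF p x])
  qed (use p in auto)
  moreover have "z i \<le> z (i + k) + of_int l" for i
  proof -
    have fz: "f j i \<le> z i" if "j \<in> {0..<p}" for j i
      unfolding z_def using that by (intro Max_ge) auto
    have "f j i \<le> z (i + k) + of_int l" if j: "j \<in> {0..<p}" for j
    proof -
      have step: "f j i = f (j + 1) (i + k) + of_int l" by (simp add: f_def algebra_simps)
      show ?thesis
      proof (cases "j + 1 < p")
        case True
        then show ?thesis using step fz[of "j + 1" "i + k"] j by simp
      next
        case False
        then have jp: "j + 1 = p" using j by auto
        have "f p (i + k) = x (i + k + (- k) * p) - of_int (p * l)" by (simp add: f_def algebra_simps)
        also have "\<dots> = x (i + k) - of_int (k * q + l * p)"
          unfolding periodic_seqs_int[OF minimizersD(1)[OF x]] by (simp add: algebra_simps)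
        also have "\<dots> \<le> f 0 (i + k)"
          using kl by (simp add: f_def del: of_int_add of_int_mult)
        finally show ?thesis using step jp fz[of 0 "i + k"] p by simp
      qed
    qed
    then show ?thesis unfolding z_def[of i] using p by (intro Max.boundedI) auto
  qed
  ultimately show ?thesis using that by blast
qed

lemma W_multiple:
  assumes x: "x \<in> periodic_seqs p q" and p: "p \<ge> 1"
  shows "W (int n * p) x = real n * W p x"
proof (induction n)
  case (Suc n)
  have "W (int (Suc n) * p) x = seg 0 (int n * p) x + seg (int n * p) (int n * p + p) x"
    unfolding periodic_action_eq using p segment_action_split[of 0 "int n * p" "int (Suc n) * p" S x]
    by (simp add: algebra_simps)
  with Suc show ?case by (simp only: seg_periodic[OF x p] periodic_action_eq[symmetric]) (simp add: algebra_simps)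
qed (simp add: periodic_action_def)

text \<open>The translation by \<open>(p, - q)\<close> has drift 0 on sequences of type
  \<open>(n * p, n * q)\<close>. A minimizer monotone under it returns to itself after
  \<open>n\<close> iterations, so it is invariant, that is, of type \<open>(p, q)\<close>.\<close>

lemma min_action_multiple:
  assumes p: "p \<ge> 1" and n: "n \<ge> 1"
  shows "real n * mn p q \<le> mn (int n * p) (int n * q)"
proof -
  have np: "int n * p \<ge> 1" using p n by (simp add: int_one_le_iff_zero_less)
  obtain z where z: "z \<in> minimizers (int n * p) (int n * q)" "\<And>i. z i \<le> z (i + p) + of_int (- q)"
    by (rule monotone_minimizer_exists[OF np, of p "int n * q" "- q"]) auto
  have "z \<in> periodic_seqs p q"
  proof (rule periodic_seqsI)
    fix i
    have "z (i + 1 * p) + of_int (1 * - q) \<le> z (i + int n * p) + of_int (int n * - q)"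
      by (rule iterated_translate_mono) (use z(2) n in auto)
    then have "z (i + p) - of_int q \<le> z i"
      unfolding periodic_seqsD[OF minimizersD(1)[OF z(1)]] by simp
    then show "z (i + p) = z i + of_int q" using z(2)[of i] by simp
  qed
  then have "real n * mn p q \<le> W (int n * p) z"
    using W_multiple[OF _ p] min_action_facts(2)[OF p] by (simp add: mult_left_mono)
  then show ?thesis using minimizersD(2)[OF z(1)] by simp
qed

section \<open>Gluing of segments\<close>

text \<open>Only the last \<open>r\<close> windows can reach index \<open>n\<close> or beyond; all
  others agree.\<close>

lemma seg_tail:
  assumes L: "lip K L" and inc: "increments_le K x" "increments_le K y"
    and eq: "\<And>i. m \<le> i \<Longrightarrow> i < n \<Longrightarrow> x i = y i"
    and D: "\<And>i. n \<le> i \<Longrightarrow> i < n + int r \<Longrightarrow> \<bar>x i - y i\<bar> \<le> D"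
  shows "\<bar>seg m n x - seg m n y\<bar> \<le> real r * L * D"
proof -
  have D0: "D \<ge> 0" using D[of n] r abs_ge_zero[of "x n - y n"] by linarith
  have L0: "L \<ge> 0" using L by (simp add: lipschitz_windows_def)
  let ?g = "\<lambda>j. S (\<lambda>i. x (j + int i)) - S (\<lambda>i. y (j + int i))"
  have "\<bar>seg m n x - seg m n y\<bar> = \<bar>\<Sum>j = m..<n. ?g j\<bar>"
    by (simp add: segment_action_def sum_subtractf)
  also have "\<dots> \<le> (\<Sum>j = m..<n. \<bar>?g j\<bar>)" by (rule sum_abs)
  also have "\<dots> \<le> (\<Sum>j = m..<n. if n - int r \<le> j then L * D else 0)"
  proof (rule sum_mono)
    fix j assume j: "j \<in> {m..<n}"
    show "\<bar>?g j\<bar> \<le> (if n - int r \<le> j then L * D else 0)"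
    proof (cases "n - int r \<le> j")
      case True
      have "\<bar>?g j\<bar> \<le> L * D"
      proof (rule lipschitz_windowsD[OF L inc])
        fix i assume i: "i \<le> r"
        show "\<bar>x (j + int i) - y (j + int i)\<bar> \<le> D"
          using eq[of "j + int i"] D[of "j + int i"] D0 i j by (cases "j + int i < n") auto
      qed
      with True show ?thesis by simp
    next
      case False
      have "S (\<lambda>i. x (j + int i)) = S (\<lambda>i. y (j + int i))"
        by (rule local_potentialD[OF loc], rule eq) (use False j in auto)
      with False show ?thesis by simp
    qed
  qed
  also have "\<dots> = (\<Sum>j\<in>{m..<n} \<inter> {n - int r..}. L * D)"
    by (subst sum.inter_restrict) (auto intro!: sum.cong)
  also have "\<dots> \<le> real r * (L * D)"
  proof -
    have "card ({m..<n} \<inter> {n - int r..}) \<le> card {n - int r..<n}" by (rule card_mono) auto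
    then show ?thesis using L0 D0 by (simp add: mult_right_mono)
  qed
  finally show ?thesis by simp
qed

text \<open>The defect of \<open>y\<close> from closing up after \<open>p\<close> steps is only felt on a stretch of length \<open>r\<close>.\<close>

lemma closing:
  assumes p: "p \<ge> 1" and inc: "increments_le K y"
    and D: "(\<Sum>k = m..<m + int r. \<bar>y (k + p) - of_int q - y k\<bar>) \<le> D" and DK: "D \<le> K'"
    and L: "lip (K + K') L"
  obtains u where "u \<in> periodic_seqs p q" "\<And>i. m \<le> i \<Longrightarrow> i < m + p \<Longrightarrow> u i = y i"
    "increments_le (K + K') u" "\<bar>W p u - seg m (m + p) y\<bar> \<le> real r * L * D"
proof -
  let ?d = "\<lambda>k. \<bar>y (k + p) - of_int q - y k\<bar>"
  define u where "u i = y (m + (i - m) mod p) + of_int ((i - m) div p) * of_int q" for i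
  have per: "u \<in> periodic_seqs p q"
  proof (rule periodic_seqsI)
    fix i
    have "i + p - m = (i - m) + p" by simp
    then have "(i + p - m) mod p = (i - m) mod p" "(i + p - m) div p = (i - m) div p + 1"
      using p by (metis mod_add_self2, metis div_add_self2 not_one_le_zero)
    then show "u (i + p) = u i + of_int q" by (simp add: u_def algebra_simps)
  qed
  have eq: "u i = y i" if "m \<le> i" "i < m + p" for i
    using that by (simp add: u_def)
  have dm: "?d m \<le> D"
  proof -
    have "?d m \<le> (\<Sum>k = m..<m + int r. ?d k)" using r by (intro member_le_sum[where f = ?d]) auto
    with D show ?thesis by simp
  qed
  have D0: "D \<ge> 0" using dm by linarith
  \<comment> \<open>The only new increments are at the seams; \<open>K'\<close> absorbs the defect
    there.\<close>
  have incu: "increments_le (K + K') u" unfolding increments_le_def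
  proof
    fix i
    let ?j = "m + (i - m) mod p" and ?n = "(i - m) div p"
    have j: "m \<le> ?j" "?j < m + p" using p by auto
    have i: "i = ?j + ?n * p" "i + 1 = (?j + 1) + ?n * p"
      using mod_div_mult_eq[of "i - m" p] by linarith+
    have "u i = u ?j + of_int ?n * of_int q" "u (i + 1) = u (?j + 1) + of_int ?n * of_int q"
      using periodic_seqs_int[OF per, of ?j ?n] periodic_seqs_int[OF per, of "?j + 1" ?n] i by metis+
    then have 1: "\<bar>u (i + 1) - u i\<bar> = \<bar>u (?j + 1) - y ?j\<bar>" using eq[OF j] by simp
    have 2: "\<bar>y (?j + 1) - y ?j\<bar> \<le> K" using inc by (rule increments_leD)
    have "\<bar>u (?j + 1) - y (?j + 1)\<bar> \<le> D"
    proof (cases "?j + 1 < m + p")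
      case True
      then show ?thesis using eq[of "?j + 1"] j D0 by simp
    next
      case False
      then have jp: "?j + 1 = m + p" using j by simp
      have "u (m + p) = y m + of_int q" using periodic_seqsD[OF per, of m] eq[of m] p by simp
      then show ?thesis unfolding jp using dm by simp
    qed
    with 1 2 DK show "\<bar>u (i + 1) - u i\<bar> \<le> K + K'" by linarith
  qed
  \<comment> \<open>As \<open>r\<close> may exceed \<open>p\<close>, the tail can run through
    several periods. Each of them adds a displacement at a different index, so the sum over one
    stretch of length \<open>r\<close> bounds the total; hence the hypothesis on a sum rather than
    on a maximum.\<close>
  have near: "\<bar>u i - y i\<bar> \<le> (\<Sum>k = m..<i - p + 1. ?d k)" if "m \<le> i" for i
    using that
  proof (induction "nat (i - m)" arbitrary: i rule: less_induct)
    case less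
    show ?case
    proof (cases "i < m + p")
      case True
      then have "\<bar>u i - y i\<bar> = 0" using eq less.prems by simp
      also have "\<dots> \<le> (\<Sum>k = m..<i - p + 1. ?d k)" by (intro sum_nonneg) auto
      finally show ?thesis .
    next
      case False
      have "\<bar>u (i - p) - y (i - p)\<bar> \<le> (\<Sum>k = m..<i - p - p + 1. ?d k)"
        by (rule less.hyps) (use False p in auto)
      also have "\<dots> \<le> (\<Sum>k = m..<i - p. ?d k)" using p by (intro sum_mono2) auto
      finally have 1: "\<bar>u (i - p) - y (i - p)\<bar> \<le> (\<Sum>k = m..<i - p. ?d k)" .
      have "{m..<i - p + 1} = insert (i - p) {m..<i - p}" using False by auto
      then have 2: "(\<Sum>k = m..<i - p + 1. ?d k) = ?d (i - p) + (\<Sum>k = m..<i - p. ?d k)" by simp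
      have "u i = u (i - p) + of_int q" using periodic_seqsD[OF per, of "i - p"] by simp
      then have "\<bar>u i - y i\<bar> \<le> \<bar>u (i - p) - y (i - p)\<bar> + ?d (i - p)" by simp
      with 1 2 show ?thesis by linarith
    qed
  qed
  have "\<bar>seg m (m + p) u - seg m (m + p) y\<bar> \<le> real r * L * D"
  proof (rule seg_tail[OF L incu])
    show "increments_le (K + K') y" using increments_le_mono[OF inc] D0 DK by simp
  next
    fix i assume "m + p \<le> i" "i < m + p + int r"
    then have "\<bar>u i - y i\<bar> \<le> (\<Sum>k = m..<i - p + 1. ?d k)" using p by (intro near) simp
    also have "\<dots> \<le> (\<Sum>k = m..<m + int r. ?d k)"
      using \<open>i < m + p + int r\<close> by (intro sum_mono2) auto
    finally show "\<bar>u i - y i\<bar> \<le> D" using D by simp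
  qed (use eq in auto)
  then have "\<bar>W p u - seg m (m + p) y\<bar> \<le> real r * L * D" using seg_periodic[OF per p] by simp
  with that per eq incu show ?thesis by blast
qed

text \<open>
  Convexity of the average minimal action: \<open>n\<close> periods of a minimizer of each kind are glued
  together at a cost that does not depend on \<open>n\<close>.
\<close>

lemma min_action_add:
  assumes p: "p \<ge> 1" "p' \<ge> 1"
  shows "mn (p + p') (q + q') \<le> mn p q + mn p' q'"
proof -
  obtain x where x: "x \<in> minimizers p q" using min_action_facts(1)[OF p(1)] by blast
  obtain x' where x': "x' \<in> minimizers p' q'" using min_action_facts(1)[OF p(2)] by blast
  note per = minimizersD(1)[OF x] and per' = minimizersD(1)[OF x']
  obtain K1 where K1: "K1 \<ge> 0" "increments_le K1 x" using periodic_seqs_increments[OF per p(1)] by blast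
  obtain K2 where K2: "K2 \<ge> 0" "increments_le K2 x'" using periodic_seqs_increments[OF per' p(2)] by blast
  \<comment> \<open>The last summand is the jump from the final entry of the first part to the
    initial entry of the second, the same for every number of periods.\<close>
  define K where "K = K1 + K2 + \<bar>x' 0 - x (- 1)\<bar>"
  define D where "D = (\<Sum>k = 0..<int r. \<bar>x' k - x k\<bar>)"
  have D: "\<bar>x' k - x k\<bar> \<le> D" if "0 \<le> k" "k < int r" for k
    unfolding D_def using that by (intro member_le_sum[where f = "\<lambda>k. \<bar>x' k - x k\<bar>"]) auto
  have D0: "D \<ge> 0" unfolding D_def by (intro sum_nonneg) auto
  have K0: "K \<ge> 0" using K1 K2 by (simp add: K_def)
  obtain L where L: "lip (K + D) L"
    using lipschitz_windows_exists[OF add_nonneg_nonneg[OF K0 D0]] by blast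
  \<comment> \<open>\<open>n \<ge> r\<close> keeps the first \<open>r\<close> entries of
    \<open>s\<close> in the part taken from \<open>x\<close>. One error is paid at the middle
    junction and one for closing up.\<close>
  have bound: "real n * mn (p + p') (q + q') \<le> real n * (mn p q + mn p' q') + 2 * (real r * L * D)"
    if n: "n \<ge> r" for n
  proof -
    have n1: "n \<ge> 1" using n r by simp
    let ?N = "int n * p" and ?N' = "int n * p'"
    have "int n * 1 \<le> ?N" "int n * 1 \<le> ?N'" using p by (intro mult_left_mono; simp)+
    then have N: "?N \<ge> int r" "?N' \<ge> 1" using n n1 by linarith+
    define s where "s i = (if i < ?N then x i else x' (i - ?N) + of_int (int n * q))" for i
    have shift: "x (k + ?N) = x k + of_int (int n * q)" "x' (k + ?N') = x' k + of_int (int n * q')" for k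
      using periodic_seqs_int[OF per] periodic_seqs_int[OF per'] by simp_all
    have incs: "increments_le K s" unfolding increments_le_def
    proof
      fix i
      consider "i + 1 < ?N" | "i + 1 = ?N" | "?N \<le> i" by linarith
      then show "\<bar>s (i + 1) - s i\<bar> \<le> K"
      proof cases
        case 1
        then show ?thesis using increments_leD[OF K1(2), of i] K2(1) by (simp add: s_def K_def)
      next
        case 2
        then have "i = - 1 + ?N" by simp
        then have "x i = x (- 1) + of_int (int n * q)" using shift(1) by metis
        then have "\<bar>s (i + 1) - s i\<bar> = \<bar>x' 0 - x (- 1)\<bar>" using 2 by (simp add: s_def)
        then show ?thesis using K1 K2 by (simp add: K_def)
      next
        case 3
        then show ?thesis using increments_leD[OF K2(2), of "i - ?N"] K1(1)
          by (simp add: s_def K_def algebra_simps)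
      qed
    qed
    have P: "int n * (p + p') \<ge> 1" using N r by (simp add: distrib_left)
    have "(\<Sum>k = 0..<0 + int r. \<bar>s (k + int n * (p + p')) - of_int (int n * (q + q')) - s k\<bar>) = D"
      unfolding D_def
    proof (rule sum.cong)
      fix k assume k: "k \<in> {0..<int r}"
      have "s (k + int n * (p + p')) = x' (k + ?N') + of_int (int n * q)"
        using k N by (simp add: s_def distrib_left)
      then show "\<bar>s (k + int n * (p + p')) - of_int (int n * (q + q')) - s k\<bar> = \<bar>x' k - x k\<bar>"
        unfolding shift using k N by (simp add: s_def algebra_simps)
    qed simp
    from closing[OF P incs eq_refl[OF this] order_refl L]
    obtain u where u: "u \<in> periodic_seqs (int n * (p + p')) (int n * (q + q'))"
      "\<bar>W (int n * (p + p')) u - seg 0 (0 + int n * (p + p')) s\<bar> \<le> real r * L * D"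
      by blast
    have "real n * mn (p + p') (q + q') \<le> W (int n * (p + p')) u"
      using min_action_multiple[of "p + p'" n "q + q'"] min_action_facts(2)[OF P u(1)] p n1 by simp
    moreover have "seg 0 (0 + int n * (p + p')) s = seg 0 ?N s + seg ?N (?N + ?N') s"
      using N segment_action_split[of 0 ?N "?N + ?N'" S s] by (simp add: distrib_left)
    moreover have "seg ?N (?N + ?N') s = real n * mn p' q'"
    proof -
      have "seg ?N (?N + ?N') s = seg (0 + ?N) (?N' + ?N) (\<lambda>i. x' (i - ?N) + of_int (int n * q))"
        by (simp only: add_0 add.commute[of ?N']) (rule segment_action_cong, simp add: s_def)
      also have "\<dots> = seg 0 ?N' x'" unfolding segment_action_shift seg_add_int by simp
      finally show ?thesis
        using W_multiple[OF per' p(2)] minimizersD(2)[OF x'] by (simp add: periodic_action_eq)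
    qed
    moreover have "\<bar>seg 0 ?N s - seg 0 ?N x\<bar> \<le> real r * L * D"
    proof (rule seg_tail[OF L])
      show "increments_le (K + D) s" "increments_le (K + D) x"
        using increments_le_mono[OF incs] increments_le_mono[OF K1(2)] K2 D0 by (auto simp: K_def)
    next
      fix i assume i: "?N \<le> i" "i < ?N + int r"
      have "x i = x (i - ?N) + of_int (int n * q)" using shift(1)[of "i - ?N"] by simp
      then show "\<bar>s i - x i\<bar> \<le> D" using D[of "i - ?N"] i by (simp add: s_def)
    qed (simp add: s_def)
    moreover have "seg 0 ?N x = real n * mn p q"
      using W_multiple[OF per p(1)] minimizersD(2)[OF x] by (simp add: periodic_action_eq)
    ultimately show ?thesis using u(2) by (simp add: distrib_left)
  qed
  show ?thesis
  proof (rule ccontr)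
    assume "\<not> ?thesis"
    then have pos: "mn (p + p') (q + q') - (mn p q + mn p' q') > 0" (is "?e > 0") by simp
    obtain n where n: "real n * ?e > 2 * (real r * L * D)" using reals_Archimedean3[OF pos] by blast
    have "real (max n r) * ?e \<le> 2 * (real r * L * D)" using bound[of "max n r"] by (simp add: algebra_simps)
    moreover have "real n * ?e \<le> real (max n r) * ?e" using pos by (intro mult_right_mono) auto
    ultimately show False using n by linarith
  qed
qed

end

subsection \<open>Comparison of barriers\<close>

lemma lipschitz_windows_antimono:
  "lipschitz_windows r S K' L \<Longrightarrow> K \<le> K' \<Longrightarrow> lipschitz_windows r S K L"
  unfolding lipschitz_windows_def using increments_le_mono by blast

lemma birkhoff_rational_increments:
  "birkhoff \<rho> y \<Longrightarrow> \<bar>\<rho>\<bar> \<le> R \<Longrightarrow> increments_le (R + 1) y"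
  using birkhoff_increments increments_le_mono by (metis add_le_cancel_right)

context monotone_potential
begin

lemma birkhoff_minimizer_exists:
  assumes p: "p \<ge> 1" and cop: "coprime p q"
  obtains x k l where "x \<in> minimizers p q" "k * q + l * p = 1"
    "\<And>i. x i \<le> x (i + k) + of_int l" "birkhoff (of_int q / of_int p) x"
proof -
  obtain k l where kl: "k * q + l * p = 1"
    using bezout_int[of q p] cop by (metis coprime_commute coprime_imp_gcd_eq_1)
  obtain x where x: "x \<in> minimizers p q" "\<And>i. x i \<le> x (i + k) + of_int l"
    by (rule monotone_minimizer_exists[OF p, of k q l]) (use kl in auto)
  show ?thesis
    by (rule that[OF x(1) kl x(2) birkhoffI[OF minimizersD(1)[OF x(1)] p kl x(2)]])
qed

text \<open>
  A pinned minimizer may be truncated between two consecutive translates of a Birkhoff minimizer,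
  which forces it to be Birkhoff itself.
\<close>

lemma birkhoff_pinned_exists:
  assumes p: "p \<ge> 1" and cop: "coprime p q"
  obtains y where "y \<in> periodic_seqs p q" "y 0 = \<xi>" "W p y = pn p q \<xi>"
    "birkhoff (of_int q / of_int p) y"
proof -
  obtain x k l where x: "x \<in> minimizers p q" and kl: "k * q + l * p = 1"
    and mono: "\<And>i. x i \<le> x (i + k) + of_int l"
    using birkhoff_minimizer_exists[OF p cop] by metis
  note per = minimizersD(1)[OF x]
  define t where "t n i = x (i + n * k) + of_int (n * l)" for n i
  have t: "t n \<in> minimizers p q" for n
    unfolding t_def[abs_def] by (rule minimizers_translate[OF p x])
  have "t (n + p) 0 = t n 0 + 1" for n
    using iterated_translate_period[OF per, of 0 n k l] unfolding kl t_def by simp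
  then obtain n where n: "t n 0 \<le> \<xi>" "\<xi> \<le> t (n + 1) 0"
    using discrete_crossing[OF p, of 1 "\<lambda>n. t n 0" \<xi>] by auto
  define a b where "a = t n" and "b = t (n + 1)"
  have a: "a \<in> minimizers p q" and b: "b \<in> minimizers p q" using t by (simp_all add: a_def b_def)
  have ab: "b i = a (i + k) + of_int l" for i
    by (simp add: a_def b_def t_def algebra_simps)
  have le: "a i \<le> b i" for i
    unfolding a_def b_def t_def by (rule iterated_translate_mono[of x k l n "n + 1" i, OF mono]) simp
  obtain w where w: "w \<in> periodic_seqs p q" "w 0 = \<xi>" "W p w = pn p q \<xi>"
    using pinned_action_facts(1)[OF p] by blast
  define v where "v i = max (w i) (a i)" for i
  define y where "y i = min (v i) (b i)" for i
  have v: "v \<in> periodic_seqs p q" unfolding v_def[abs_def]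
    by (intro periodic_seqs_max w(1) minimizersD(1)[OF a])
  have y: "y \<in> periodic_seqs p q" unfolding y_def[abs_def]
    by (intro periodic_seqs_min v minimizersD(1)[OF b])
  have v0: "v 0 = \<xi>" using w(2) n by (simp add: v_def a_def)
  have y0: "y 0 = \<xi>" using v0 n by (simp add: y_def b_def)
  have ay: "a i \<le> y i" and yb: "y i \<le> b i" for i
    using le[of i] by (auto simp: y_def v_def)
  have "W p (\<lambda>i. min (w i) (a i)) + W p v \<le> W p w + W p a"
    unfolding v_def periodic_action_eq by (rule seg_submodular)
  moreover have "mn p q \<le> W p (\<lambda>i. min (w i) (a i))"
    by (intro min_action_facts(2)[OF p] periodic_seqs_min w(1) minimizersD(1)[OF a])
  moreover have "W p y + W p (\<lambda>i. max (v i) (b i)) \<le> W p v + W p b"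
    unfolding y_def periodic_action_eq by (rule seg_submodular)
  moreover have "mn p q \<le> W p (\<lambda>i. max (v i) (b i))"
    by (intro min_action_facts(2)[OF p] periodic_seqs_max v minimizersD(1)[OF b])
  ultimately have "W p y \<le> pn p q \<xi>"
    using minimizersD(2)[OF a] minimizersD(2)[OF b] w(3) by linarith
  then have Wy: "W p y = pn p q \<xi>" using pinned_action_facts(2)[OF p y y0] by linarith
  \<comment> \<open>\<open>b\<close> is the \<open>(k, l)\<close>-translate of \<open>a\<close>, so
    lying between the two orders \<open>y\<close> with respect to its own translate.\<close>
  have "y i \<le> y (i + k) + of_int l" for i
    using yb[of i] ay[of "i + k"] ab[of i] by linarith
  then have "birkhoff (of_int q / of_int p) y" by (rule birkhoffI[OF y p kl])
  with y y0 Wy show ?thesis by (rule that)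
qed

text \<open>Some integer translate of a Birkhoff minimizer passes within 1 of \<open>\<xi>\<close>
  at index 0. Moving that single entry changes one window, at cost \<open>L\<close>, and closing up
  costs \<open>r * L\<close>. This crude bound serves rationals that are far apart.\<close>

lemma barrier_bounded:
  assumes p: "p \<ge> 1" and cop: "coprime p q" and R: "\<bar>of_int q / of_int p\<bar> \<le> R"
    and L: "lip (R + 2 + 1) L"
  shows "pn p q \<xi> - mn p q \<le> (real r + 1) * L"
proof -
  obtain x where x: "x \<in> minimizers p q" "birkhoff (of_int q / of_int p) x"
    using birkhoff_minimizer_exists[OF p cop] by metis
  define y where "y i = x (i + 0) + of_int \<lfloor>\<xi> - x 0\<rfloor>" for i
  have y: "y \<in> minimizers p q" unfolding y_def[abs_def] by (rule minimizers_translate[OF p x(1)])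
  have "birkhoff (of_int q / of_int p) y" unfolding y_def[abs_def] by (rule birkhoff_shift[OF x(2)])
  then have incy: "increments_le (R + 1) y" using R by (rule birkhoff_rational_increments)
  note per = minimizersD(1)[OF y]
  have y0: "\<bar>\<xi> - y 0\<bar> \<le> 1" by (simp add: y_def) linarith
  define s where "s i = (if i = 0 then \<xi> else y i)" for i
  have incs: "increments_le (R + 2) s" unfolding increments_le_def
  proof
    fix i :: int
    consider "i = 0" | "i + 1 = 0" | "i \<noteq> 0" "i + 1 \<noteq> 0" by blast
    then show "\<bar>s (i + 1) - s i\<bar> \<le> R + 2"
    proof cases
      case 1
      then show ?thesis using increments_leD[OF incy, of i] y0 by (simp add: s_def)
    next
      case 2
      then show ?thesis using increments_leD[OF incy, of i] y0 by (simp add: s_def)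
    next
      case 3
      then show ?thesis using increments_leD[OF incy, of i] by (simp add: s_def)
    qed
  qed
  have "(\<Sum>k = 0..<0 + int r. \<bar>s (k + p) - of_int q - s k\<bar>)
      = (\<Sum>k = 0..<int r. if k = 0 then \<bar>y 0 - \<xi>\<bar> else 0)"
    using p periodic_seqsD[OF per] by (intro sum.cong) (auto simp: s_def)
  also have "\<dots> \<le> 1" using y0 r by (simp add: abs_minus_commute)
  finally have sum: "(\<Sum>k = 0..<0 + int r. \<bar>s (k + p) - of_int q - s k\<bar>) \<le> 1" .
  obtain u where u: "u \<in> periodic_seqs p q" "\<And>i. 0 \<le> i \<Longrightarrow> i < 0 + p \<Longrightarrow> u i = s i"
    "\<bar>W p u - seg 0 (0 + p) s\<bar> \<le> real r * L * 1"
    using closing[OF p incs sum order_refl L] by blast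
  have "u 0 = \<xi>" using u(2)[of 0] p by (simp add: s_def)
  then have "pn p q \<xi> \<le> W p u" by (rule pinned_action_facts(2)[OF p u(1)])
  moreover have "\<bar>seg 0 p s - seg 0 p y\<bar> \<le> L"
  proof -
    have "{0..<p} = insert 0 {1..<p}" using p by auto
    then have "seg 0 p z = S (\<lambda>i. z (0 + int i)) + (\<Sum>j = 1..<p. S (\<lambda>i. z (j + int i)))" for z
      by (simp add: segment_action_def)
    moreover have "(\<Sum>j = 1..<p. S (\<lambda>i. s (j + int i))) = (\<Sum>j = 1..<p. S (\<lambda>i. y (j + int i)))"
      by (intro sum.cong refl arg_cong[where f = S]) (auto simp: s_def)
    moreover have "\<bar>S (\<lambda>i. s (0 + int i)) - S (\<lambda>i. y (0 + int i))\<bar> \<le> L * 1"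
    proof (rule lipschitz_windowsD[OF L])
      show "increments_le (R + 2 + 1) s" "increments_le (R + 2 + 1) y"
        using increments_le_mono[OF incs] increments_le_mono[OF incy] by simp_all
      show "\<bar>s (0 + int i) - y (0 + int i)\<bar> \<le> 1" for i using y0 by (simp add: s_def)
    qed
    ultimately show ?thesis by simp
  qed
  moreover have "seg 0 p y = mn p q" using minimizersD(2)[OF y] by (simp add: periodic_action_eq)
  ultimately show ?thesis using u(3) by (simp add: distrib_right)
qed

lemma min_action_le_segment:
  assumes p: "p \<ge> 1" and inc: "increments_le K y"
    and D: "(\<Sum>k = m..<m + int r. \<bar>y (k + p) - of_int q - y k\<bar>) \<le> D" and DK: "D \<le> K'"
    and L: "lip (K + K') L"
  shows "mn p q - real r * L * D \<le> seg m (m + p) y"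
proof -
  obtain u where u: "u \<in> periodic_seqs p q" "\<bar>W p u - seg m (m + p) y\<bar> \<le> real r * L * D"
    using closing[OF p inc D DK L] by blast
  then show ?thesis using min_action_facts(2)[OF p u(1)] by linarith
qed

text \<open>The rest of the period has type \<open>(P - p, Q - q)\<close> and, since
  \<open>y\<close> has type \<open>(P, Q)\<close>, the same closing defect. Its action is bounded
  from below by closing it up, and convexity turns this into an upper bound on the segment.\<close>

lemma segment_le_min_action:
  assumes pP: "p \<ge> 1" "p < P" and y: "y \<in> periodic_seqs P Q" and inc: "increments_le K y"
    and D: "(\<Sum>k = m..<m + int r. \<bar>y (k + p) - of_int q - y k\<bar>) \<le> D" and DK: "D \<le> K'"
    and L: "lip (K + K') L"
  shows "seg m (m + p) y \<le> W P y - mn P Q + mn p q + real r * L * D"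
proof -
  have "(\<Sum>k = m + p..<m + int r + p. \<bar>y (k + (P - p)) - of_int (Q - q) - y k\<bar>)
      = (\<Sum>k = m..<m + int r. \<bar>y (k + p) - of_int q - y k\<bar>)"
    unfolding sum_int_shift
  proof (rule sum.cong)
    fix k
    have "y (k + p + (P - p)) = y k + of_int Q" using periodic_seqsD[OF y, of k] by simp
    then show "\<bar>y (k + p + (P - p)) - of_int (Q - q) - y (k + p)\<bar> = \<bar>y (k + p) - of_int q - y k\<bar>"
      by simp
  qed simp
  then have "(\<Sum>k = m + p..<(m + p) + int r. \<bar>y (k + (P - p)) - of_int (Q - q) - y k\<bar>) \<le> D"
    using D by (simp add: algebra_simps)
  moreover have "P - p \<ge> 1" using pP by simp
  ultimately have "mn (P - p) (Q - q) - real r * L * D \<le> seg (m + p) (m + p + (P - p)) y"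
    using min_action_le_segment[where p = "P - p" and q = "Q - q" and m = "m + p", OF _ inc _ DK L] by blast
  moreover have "seg m (m + p) y + seg (m + p) (m + P) y = W P y"
  proof -
    have "seg m (m + P) y = seg m (m + p) y + seg (m + p) (m + P) y"
      by (rule segment_action_split) (use pP in auto)
    then show ?thesis using seg_periodic[OF y, of m] pP by simp
  qed
  moreover have "mn P Q \<le> mn p q + mn (P - p) (Q - q)"
    using min_action_add[of p "P - p" q "Q - q"] pP by simp
  ultimately show ?thesis by simp
qed

text \<open>The \<open>p\<close> candidates for \<open>m\<close> are exactly those whose stretch
  contains the pinned index 0. Displacements at both ends sum to at most \<open>2 * A\<close> over
  one period, and the mean \<open>2 * real r * A / p\<close> is at most \<open>4 * real r\<close>
  times the parenthesis.\<close>

lemma almost_closed_place: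
  assumes y: "birkhoff \<rho> y" and p: "p \<ge> 1" and cop: "coprime p q"
  obtains m where "m \<le> 0" "0 < m + p"
    "(\<Sum>k = m..<m + int r. \<bar>y (k + p) - of_int q - y k\<bar> + \<bar>y (k + p + p) - of_int q - y (k + p)\<bar>)
      \<le> 4 * real r * (1 / of_int p + \<bar>of_int p * \<rho> - of_int q\<bar>)"
proof -
  define A where "A = 2 * of_int p * \<bar>of_int p * \<rho> - of_int q\<bar> + 1"
  let ?d = "\<lambda>k. \<bar>y (k + p) - of_int q - y k\<bar>"
  have A: "(\<Sum>i = s..<s + p. ?d i) \<le> A" for s
    unfolding A_def by (rule birkhoff_displacement[OF y p cop])
  have "(\<Sum>i = s..<s + p. ?d i + ?d (i + p)) \<le> 2 * A" for s
    using A[of s] A[of "s + p"] sum_int_shift[of ?d s p "s + p"] by (simp add: sum.distrib)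
  then obtain m where m: "m \<in> {1 - p..<1 - p + p}"
    "(\<Sum>k = m..<m + int r. ?d k + ?d (k + p)) \<le> real r * (2 * A) / of_int p"
    using small_window_exists[OF p, of "\<lambda>k. ?d k + ?d (k + p)"] by blast
  have "real r * (2 * A) / of_int p = real r * (2 / of_int p + 4 * \<bar>of_int p * \<rho> - of_int q\<bar>)"
    using p unfolding A_def by (simp add: field_simps)
  also have "\<dots> \<le> real r * (4 * (1 / of_int p + \<bar>of_int p * \<rho> - of_int q\<bar>))"
    using p by (intro mult_left_mono) (auto simp: field_simps)
  also have "\<dots> = 4 * real r * (1 / of_int p + \<bar>of_int p * \<rho> - of_int q\<bar>)" by simp
  finally have "real r * (2 * A) / of_int p \<le> 4 * real r * (1 / of_int p + \<bar>of_int p * \<rho> - of_int q\<bar>)" .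
  with m(2) show ?thesis using m(1) by (intro that[of m] order_trans[OF m(2)]) auto
qed

text \<open>
  A pinned minimizer of the longer period is cut where it almost closes up into two periodic pieces,
  of which the one of period \<open>p\<close> is pinned; convexity bounds the action of the other one.
\<close>

lemma barrier_le_longer_period:
  assumes p: "p \<ge> 1" and cop: "coprime p q" and P: "p < P" and copP: "coprime P Q"
    and R: "\<bar>of_int Q / of_int P\<bar> \<le> R"
    and \<epsilon>: "\<epsilon> = 1 / of_int p + \<bar>of_int p * (of_int Q / of_int P) - of_int q\<bar>" "\<epsilon> \<le> 2"
    and L: "lip (R + 1 + 8 * real r) L"
  shows "pn p q \<xi> - mn p q \<le> pn P Q \<xi> - mn P Q + 8 * (real r)\<^sup>2 * L * \<epsilon>"
proof -
  have P1: "P \<ge> 1" using p P by simp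
  obtain y where y: "y \<in> periodic_seqs P Q" "y 0 = \<xi>" "W P y = pn P Q \<xi>"
    "birkhoff (of_int Q / of_int P) y"
    using birkhoff_pinned_exists[OF P1 copP] by metis
  have inc: "increments_le (R + 1) y" using y(4) R by (rule birkhoff_rational_increments)
  from almost_closed_place[OF y(4) p cop, folded \<epsilon>(1)]
  obtain m where m: "m \<le> 0" "0 < m + p"
    "(\<Sum>k = m..<m + int r. \<bar>y (k + p) - of_int q - y k\<bar> + \<bar>y (k + p + p) - of_int q - y (k + p)\<bar>)
      \<le> 4 * real r * \<epsilon>"
    by blast
  let ?D = "4 * real r * \<epsilon>"
  have "(\<Sum>k = m..<m + int r. \<bar>y (k + p) - of_int q - y k\<bar>)
      \<le> (\<Sum>k = m..<m + int r. \<bar>y (k + p) - of_int q - y k\<bar> + \<bar>y (k + p + p) - of_int q - y (k + p)\<bar>)"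
    by (intro sum_mono) simp
  with m have D: "(\<Sum>k = m..<m + int r. \<bar>y (k + p) - of_int q - y k\<bar>) \<le> ?D" by linarith
  have DK: "?D \<le> 8 * real r" using \<epsilon>(2) mult_left_mono[OF \<epsilon>(2), of "4 * real r"] by simp
  obtain u where u: "u \<in> periodic_seqs p q" "\<And>i. m \<le> i \<Longrightarrow> i < m + p \<Longrightarrow> u i = y i"
    "\<bar>W p u - seg m (m + p) y\<bar> \<le> real r * L * ?D"
    using closing[OF p inc D DK L] by blast
  have "u 0 = \<xi>" using u(2)[of 0] m y(2) by simp
  then have "pn p q \<xi> \<le> W p u" by (rule pinned_action_facts(2)[OF p u(1)])
  moreover have "seg m (m + p) y \<le> W P y - mn P Q + mn p q + real r * L * ?D"
    by (rule segment_le_min_action[OF p P y(1) inc D DK L])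
  \<comment> \<open>One error for closing up the pinned piece, one for bounding its action through
    the complement; with \<open>?D\<close> inserted they give the factor 8.\<close>
  ultimately have "pn p q \<xi> - mn p q \<le> pn P Q \<xi> - mn P Q + 2 * (real r * L * ?D)"
    using u(3) y(3) by linarith
  then show ?thesis by (simp add: power2_eq_square algebra_simps)
qed

text \<open>The competitor follows \<open>c\<close> up to \<open>m + p\<close> and \<open>lo\<close>
  afterwards, closed up with period \<open>P\<close>. Because \<open>lo\<close> is periodic, the
  closing defect at \<open>m\<close> is at most the gap between \<open>c\<close> and
  \<open>lo\<close>. \<open>K'\<close> enters twice: for the jump at \<open>m + p\<close> and for
  the closing.\<close>

lemma insert_segment:
  assumes P: "P \<ge> 1" and pP: "p \<ge> 1" "p < P" and lo: "lo \<in> periodic_seqs P Q"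
    and inc: "increments_le K lo" "increments_le K c"
    and D1: "(\<Sum>k = m..<m + int r. \<bar>c k - lo k\<bar>) \<le> D"
    and D2: "\<And>k. m + p \<le> k \<Longrightarrow> k < m + p + int r \<Longrightarrow> \<bar>c k - lo k\<bar> \<le> D"
    and DK: "D \<le> K'" and L: "lip (K + K' + K') L" and m: "m \<le> 0" "0 < m + p"
  shows "pn P Q (c 0) \<le> W P lo + seg m (m + p) c - seg m (m + p) lo + 2 * (real r * L * D)"
proof -
  define s where "s i = (if i < m + p then c i else lo i)" for i
  have D0: "D \<ge> 0" using D2[of "m + p"] r abs_ge_zero[of "c (m + p) - lo (m + p)"] by linarith
  have incs: "increments_le (K + K') s" unfolding increments_le_def
  proof
    fix i
    have "\<bar>c (m + p) - lo (m + p)\<bar> \<le> D" using D2[of "m + p"] r by simp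
    then show "\<bar>s (i + 1) - s i\<bar> \<le> K + K'"
      using increments_leD[OF inc(1), of i] increments_leD[OF inc(2), of i] D0 DK
      unfolding s_def by (smt (verit))
  qed
  have "(\<Sum>k = m..<m + int r. \<bar>s (k + P) - of_int Q - s k\<bar>) \<le> (\<Sum>k = m..<m + int r. \<bar>c k - lo k\<bar>)"
  proof (rule sum_mono)
    fix k assume "k \<in> {m..<m + int r}"
    then have "s (k + P) = lo k + of_int Q" using pP periodic_seqsD[OF lo, of k] by (simp add: s_def)
    then show "\<bar>s (k + P) - of_int Q - s k\<bar> \<le> \<bar>c k - lo k\<bar>"
      by (simp add: s_def abs_minus_commute)
  qed
  with D1 have D3: "(\<Sum>k = m..<m + int r. \<bar>s (k + P) - of_int Q - s k\<bar>) \<le> D" by linarith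
  obtain u where u: "u \<in> periodic_seqs P Q" "\<And>i. m \<le> i \<Longrightarrow> i < m + P \<Longrightarrow> u i = s i"
    "\<bar>W P u - seg m (m + P) s\<bar> \<le> real r * L * D"
    using closing[OF P incs D3 DK L] by blast
  have "u 0 = c 0" using u(2)[of 0] m pP by (simp add: s_def)
  then have "pn P Q (c 0) \<le> W P u" by (rule pinned_action_facts(2)[OF P u(1)])
  moreover have "\<bar>seg m (m + p) s - seg m (m + p) c\<bar> \<le> real r * L * D"
  proof (rule seg_tail[OF L])
    show "increments_le (K + K' + K') s" "increments_le (K + K' + K') c"
      using increments_le_mono[OF incs] increments_le_mono[OF inc(2)] D0 DK by simp_all
  next
    fix i assume "m + p \<le> i" "i < m + p + int r"
    then show "\<bar>s i - c i\<bar> \<le> D" using D2[of i] by (simp add: s_def abs_minus_commute)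
  qed (simp add: s_def)
  moreover have "seg m (m + P) s = seg m (m + p) s + seg (m + p) (m + P) lo"
  proof -
    have "seg (m + p) (m + P) s = seg (m + p) (m + P) lo"
      by (rule segment_action_cong) (simp add: s_def)
    then show ?thesis using segment_action_split[of m "m + p" "m + P" S s] pP by simp
  qed
  moreover have "seg m (m + p) lo + seg (m + p) (m + P) lo = W P lo"
    using segment_action_split[of m "m + p" "m + P" S lo] pP seg_periodic[OF lo, of m] by simp
  ultimately show ?thesis using u(3) by linarith
qed

text \<open>The iterates of the translation by \<open>(p, - q)\<close> sweep past every level, since
  \<open>P\<close> of them add \<open>p * Q - q * P\<close>. The gap between consecutive iterates is
  the displacement after \<open>p\<close> steps, which is small at both ends of a well chosen
  stretch.\<close>

lemma adjacent_minimizers: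
  assumes p: "p \<ge> 1" and P: "P \<ge> 1" and copP: "coprime P Q" and ne: "p * Q \<noteq> P * q"
  obtains a b where "a \<in> minimizers P Q" "birkhoff (of_int Q / of_int P) a"
    "\<And>i. b i = a (i + p) - of_int q"
    "a 0 \<le> \<xi> \<and> \<xi> \<le> b 0 \<or> b 0 \<le> \<xi> \<and> \<xi> \<le> a 0"
proof -
  obtain x where x: "x \<in> minimizers P Q" "birkhoff (of_int Q / of_int P) x"
    using birkhoff_minimizer_exists[OF P copP] by metis
  define t where "t n i = x (i + n * p) + of_int (n * - q)" for n i
  have "t (n + P) 0 = t n 0 + of_int (p * Q + - q * P)" for n
    using iterated_translate_period[OF minimizersD(1)[OF x(1)], of 0 n p "- q"] unfolding t_def by simp
  moreover have "of_int (p * Q + - q * P) \<noteq> (0 :: real)" using ne by (simp only: of_int_eq_0_iff) (simp add: mult.commute)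
  ultimately obtain n where n: "t n 0 \<le> \<xi> \<and> \<xi> \<le> t (n + 1) 0 \<or> t (n + 1) 0 \<le> \<xi> \<and> \<xi> \<le> t n 0"
    using discrete_crossing_signed[OF P, of _ "\<lambda>n. t n 0" \<xi>] by blast
  show ?thesis
  proof (rule that[of "t n" "t (n + 1)"])
    show "t n \<in> minimizers P Q" "birkhoff (of_int Q / of_int P) (t n)"
      unfolding t_def[abs_def] by (intro minimizers_translate[OF P x(1)] birkhoff_shift[OF x(2)])+
    show "t (n + 1) i = t n (i + p) - of_int q" for i by (simp add: t_def algebra_simps)
  qed (rule n)
qed

text \<open>
  Two neighbouring translates \<open>lo \<le> hi\<close> of a minimizer of the longer period surround the pinning value
  and nearly touch at both ends of a stretch of length \<open>p\<close>. There a pinned minimizer of the shorter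
  period, clamped between them, can replace \<open>lo\<close>; submodularity controls the cost of clamping.
\<close>

lemma barrier_le_shorter_period:
  assumes p: "p \<ge> 1" and cop: "coprime p q" and P: "p < P" and copP: "coprime P Q"
    and R: "\<bar>of_int q / of_int p\<bar> \<le> R" "\<bar>of_int Q / of_int P\<bar> \<le> R"
    and \<epsilon>: "\<epsilon> = 1 / of_int p + \<bar>of_int p * (of_int Q / of_int P) - of_int q\<bar>" "\<epsilon> \<le> 2"
    and L: "lip (R + 1 + 8 * real r + 8 * real r) L"
  shows "pn P Q \<xi> - mn P Q \<le> pn p q \<xi> - mn p q + 20 * (real r)\<^sup>2 * L * \<epsilon>"
proof -
  define K where "K = R + 1"
  define D where "D = 4 * real r * \<epsilon>"
  have L': "lip (K + 8 * real r) L" using lipschitz_windows_antimono[OF L] by (simp add: K_def)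
  have P1: "P \<ge> 1" using p P by simp
  have DK: "D \<le> 8 * real r" using mult_left_mono[OF \<epsilon>(2), of "4 * real r"] by (simp add: D_def)
  have "p * Q \<noteq> P * q"
  proof
    assume "p * Q = P * q"
    then have "P dvd p" using copP by (metis coprime_dvd_mult_left_iff dvd_triv_left)
    then show False using p P zdvd_imp_le by fastforce
  qed
  from adjacent_minimizers[OF p P1 copP this, of \<xi>]
  obtain a b where a: "a \<in> minimizers P Q" "birkhoff (of_int Q / of_int P) a"
    and ab: "\<And>i. b i = a (i + p) - of_int q"
    and cross: "a 0 \<le> \<xi> \<and> \<xi> \<le> b 0 \<or> b 0 \<le> \<xi> \<and> \<xi> \<le> a 0"
    by blast
  have b': "b = (\<lambda>i. a (i + p) + of_int (- q))" using ab by auto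
  have b: "b \<in> minimizers P Q" "birkhoff (of_int Q / of_int P) b"
    unfolding b' by (intro minimizers_translate[OF P1 a(1)] birkhoff_shift[OF a(2)])+
  from almost_closed_place[OF a(2) p cop, folded \<epsilon>(1), folded D_def]
  obtain m where m: "m \<le> 0" "0 < m + p"
    and sum: "(\<Sum>k = m..<m + int r. \<bar>a (k + p) - of_int q - a k\<bar> + \<bar>a (k + p + p) - of_int q - a (k + p)\<bar>) \<le> D"
    by blast
  have da: "(\<Sum>k = m..<m + int r. \<bar>a (k + p) - of_int q - a k\<bar>) \<le> D"
    by (rule order_trans[OF sum_mono sum]) simp
  have "\<bar>b (k + p) - of_int q - b k\<bar> = \<bar>a (k + p + p) - of_int q - a (k + p)\<bar>" for k
    using ab by simp
  then have db: "(\<Sum>k = m..<m + int r. \<bar>b (k + p) - of_int q - b k\<bar>) \<le> D"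
    by (simp only:) (rule order_trans[OF sum_mono sum], simp)
  \<comment> \<open>Beyond the stretch the gap is the displacement of \<open>b\<close> taken
    \<open>p\<close> indices earlier, that is, the second summand of \<open>sum\<close>.\<close>
  have far: "\<bar>b k - a k\<bar> \<le> D" if "m + p \<le> k" "k < m + p + int r" for k
  proof -
    have "\<bar>b k - a k\<bar> = \<bar>b (k - p + p) - of_int q - b (k - p)\<bar>"
      using ab[of k] ab[of "k - p"] by (simp add: abs_minus_commute)
    also have "\<dots> \<le> (\<Sum>k = m..<m + int r. \<bar>b (k + p) - of_int q - b k\<bar>)"
      using that by (intro member_le_sum[where f = "\<lambda>k. \<bar>b (k + p) - of_int q - b k\<bar>"]) auto
    finally show ?thesis using db by linarith
  qed
  have near: "(\<Sum>k = m..<m + int r. \<bar>b k - a k\<bar>) \<le> D" using da ab by simp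
  have mono: "(\<forall>i. a i \<le> b i) \<or> (\<forall>i. b i \<le> a i)"
    using birkhoff_le[OF a(2), of p "- q"] birkhoff_ge[OF a(2), of p "- q"] ab
    by (cases "of_int p * (of_int Q / of_int P) + of_int (- q) \<ge> (0 :: real)") auto
  define lo where "lo = (if \<forall>i. a i \<le> b i then a else b)"
  define hi where "hi = (if \<forall>i. a i \<le> b i then b else a)"
  have le: "lo i \<le> hi i" for i using mono by (auto simp: lo_def hi_def)
  have "lo 0 \<le> \<xi> \<and> \<xi> \<le> hi 0"
  proof (cases "\<forall>i. a i \<le> b i")
    case True
    then have "a 0 \<le> b 0" "lo = a" "hi = b" by (auto simp: lo_def hi_def)
    then show ?thesis using cross by auto
  next
    case False
    then have "b 0 \<le> a 0" "lo = b" "hi = a" using mono by (auto simp: lo_def hi_def)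
    then show ?thesis using cross by auto
  qed
  then have cross': "lo 0 \<le> \<xi>" "\<xi> \<le> hi 0" by simp_all
  have lh: "\<bar>hi i - lo i\<bar> = \<bar>b i - a i\<bar>" for i by (simp add: lo_def hi_def abs_minus_commute)
  have ends: "s \<in> minimizers P Q \<and> increments_le K s
      \<and> (\<Sum>k = m..<m + int r. \<bar>s (k + p) - of_int q - s k\<bar>) \<le> D" if "s = lo \<or> s = hi" for s
  proof -
    have "lo \<in> {a, b}" "hi \<in> {a, b}" by (simp_all add: lo_def hi_def)
    then have "s = a \<or> s = b" using that by blast
    then show ?thesis
      using a b da db birkhoff_rational_increments[OF a(2) R(2)] birkhoff_rational_increments[OF b(2) R(2)]
      by (auto simp: K_def)
  qed
  have lo: "lo \<in> minimizers P Q" "increments_le K lo" "(\<Sum>k = m..<m + int r. \<bar>lo (k + p) - of_int q - lo k\<bar>) \<le> D"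
    and hi: "hi \<in> minimizers P Q" "increments_le K hi" "(\<Sum>k = m..<m + int r. \<bar>hi (k + p) - of_int q - hi k\<bar>) \<le> D"
    using ends[of lo] ends[of hi] by auto
  have upper: "seg m (m + p) s \<le> mn p q + real r * L * D"
    if "s \<in> minimizers P Q" "increments_le K s" "(\<Sum>k = m..<m + int r. \<bar>s (k + p) - of_int q - s k\<bar>) \<le> D" for s
    using segment_le_min_action[OF p P minimizersD(1)[OF that(1)] that(2,3) DK L'] minimizersD(2)[OF that(1)]
    by simp
  obtain w where w: "w \<in> periodic_seqs p q" "w 0 = \<xi>" "W p w = pn p q \<xi>"
    "birkhoff (of_int q / of_int p) w"
    using birkhoff_pinned_exists[OF p cop] by metis
  have incw: "increments_le K w" unfolding K_def using w(4) R(1) by (rule birkhoff_rational_increments)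
  define v where "v i = max (w i) (lo i)" for i
  define c where "c i = min (v i) (hi i)" for i
  have incv: "increments_le K v" unfolding v_def[abs_def] by (rule increments_le_max[OF incw lo(2)])
  have incc: "increments_le K c" unfolding c_def[abs_def] by (rule increments_le_min[OF incv hi(2)])
  \<comment> \<open>As \<open>w\<close> closes up exactly after \<open>p\<close> steps, the defect
    of the minimum is at most that of \<open>lo\<close>; likewise for the maximum with
    \<open>hi\<close>.\<close>
  have "mn p q - real r * L * D \<le> seg m (m + p) (\<lambda>i. min (w i) (lo i))"
  proof (rule min_action_le_segment[OF p increments_le_min[OF incw lo(2)] _ DK L'])
    show "(\<Sum>k = m..<m + int r. \<bar>min (w (k + p)) (lo (k + p)) - of_int q - min (w k) (lo k)\<bar>) \<le> D"
      by (rule order_trans[OF sum_mono lo(3)]) (use periodic_seqsD[OF w(1)] in \<open>simp add: min_def\<close>)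
  qed
  moreover have "mn p q - real r * L * D \<le> seg m (m + p) (\<lambda>i. max (w i) (hi i))"
  proof (rule min_action_le_segment[OF p increments_le_max[OF incw hi(2)] _ DK L'])
    show "(\<Sum>k = m..<m + int r. \<bar>max (w (k + p)) (hi (k + p)) - of_int q - max (w k) (hi k)\<bar>) \<le> D"
      by (rule order_trans[OF sum_mono hi(3)]) (use periodic_seqsD[OF w(1)] in \<open>simp add: max_def\<close>)
  qed
  moreover have "seg m (m + p) (\<lambda>i. min (w i) (lo i)) + seg m (m + p) v \<le> seg m (m + p) w + seg m (m + p) lo"
    unfolding v_def by (rule seg_submodular)
  moreover have "seg m (m + p) c + seg m (m + p) (\<lambda>i. max (w i) (hi i)) \<le> seg m (m + p) v + seg m (m + p) hi"
  proof -
    have "max (v i) (hi i) = max (w i) (hi i)" for i using le[of i] by (simp add: v_def max_def)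
    then show ?thesis using seg_submodular[of m "m + p" v hi] by (simp add: c_def[abs_def])
  qed
  moreover have "seg m (m + p) hi \<le> mn p q + real r * L * D" by (rule upper[OF hi])
  moreover have "seg m (m + p) w = pn p q \<xi>" using seg_periodic[OF w(1) p] w(3) by simp
  \<comment> \<open>The three errors come from the two lower bounds on the discarded minimum and
    maximum and from the upper bound on \<open>hi\<close>. Inserting \<open>c\<close> adds two more,
    and \<open>5 * 4 = 20\<close>.\<close>
  ultimately have c: "seg m (m + p) c - seg m (m + p) lo \<le> pn p q \<xi> - mn p q + 3 * (real r * L * D)"
    by linarith
  have c0: "c 0 = \<xi>" using w(2) cross' by (simp add: c_def v_def)
  have clo: "\<bar>c i - lo i\<bar> \<le> \<bar>b i - a i\<bar>" for i
    using le[of i] unfolding lh[symmetric] by (auto simp: c_def v_def min_def max_def)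
  have "pn P Q (c 0) \<le> W P lo + seg m (m + p) c - seg m (m + p) lo + 2 * (real r * L * D)"
  proof (rule insert_segment[OF P1 p P minimizersD(1)[OF lo(1)] lo(2) incc _ _ DK _ m])
    show "(\<Sum>k = m..<m + int r. \<bar>c k - lo k\<bar>) \<le> D"
      by (rule order_trans[OF sum_mono near]) (rule clo)
    show "\<bar>c k - lo k\<bar> \<le> D" if "m + p \<le> k" "k < m + p + int r" for k
      using clo[of k] far[OF that] by linarith
    show "lip (K + 8 * real r + 8 * real r) L" using L by (simp add: K_def)
  qed
  then have "pn P Q \<xi> - mn P Q \<le> pn p q \<xi> - mn p q + 5 * (real r * L * D)"
    using c c0 minimizersD(2)[OF lo(1)] by simp
  then show ?thesis by (simp add: D_def power2_eq_square algebra_simps)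
qed

end

subsection \<open>Rational approximation\<close>

lemma real_of_rat_quotient_of:
  assumes "quotient_of \<rho> = (q, p)"
  shows "real_of_rat \<rho> = of_int q / of_int p"
  using quotient_of_div[OF assms] by (simp add: of_rat_divide)

lemma coprime_fraction:
  assumes "coprime h k" "0 < k"
  obtains \<rho> where "quotient_of \<rho> = (h, k)" "real_of_rat \<rho> = of_int h / of_int k"
proof -
  have "quotient_of (Fract h k) = (h, k)" using assms by (simp add: quotient_of_Fract normalize_stable)
  then show ?thesis using real_of_rat_quotient_of that by blast
qed

text \<open>An irrational has infinitely many fractions within \<open>1 / k^2\<close>, hence some
  with \<open>k > 2 / e\<close>; then both summands are at most
  \<open>1 / k < e / 2\<close>.\<close>

lemma irrational_rational_approx:
  assumes "\<omega> \<notin> \<rat>" and e: "e > 0"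
  obtains \<rho> q p where "quotient_of \<rho> = (q, p)" "\<bar>\<omega> - real_of_rat \<rho>\<bar> < e"
    "1 / of_int p + \<bar>of_int p * \<omega> - of_int q\<bar> < e"
proof -
  have "infinite (approx_set \<omega>)" using assms(1) rational_iff_finite_approx_set by blast
  then obtain h k where hk: "(h, k) \<in> approx_set \<omega>" "k > \<lceil>2 / e\<rceil>"
    using infinite_approx_set by blast
  then have k: "0 < k" "coprime h k" "\<bar>\<omega> - of_int h / of_int k\<bar> < 1 / (of_int k)\<^sup>2"
    by (auto simp: approx_set_def)
  obtain \<rho> where \<rho>: "quotient_of \<rho> = (h, k)" "real_of_rat \<rho> = of_int h / of_int k"
    using coprime_fraction[OF k(2,1)] by blast
  have "of_int k > 2 / e" using hk(2) by linarith
  then have ke: "2 / of_int k < e" using e k(1) by (simp add: field_simps)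
  have "of_int k * \<omega> - of_int h = of_int k * (\<omega> - of_int h / of_int k)"
    using k(1) by (simp add: field_simps)
  then have "\<bar>of_int k * \<omega> - of_int h\<bar> = of_int k * \<bar>\<omega> - of_int h / of_int k\<bar>"
    using k(1) by (simp add: abs_mult)
  also have "\<dots> < of_int k * (1 / (of_int k)\<^sup>2)"
    using k by (intro mult_strict_left_mono) auto
  also have "\<dots> = 1 / of_int k" using k(1) by (simp add: power2_eq_square)
  finally have 1: "\<bar>of_int k * \<omega> - of_int h\<bar> < 1 / of_int k" .
  have "1 / (of_int k)\<^sup>2 \<le> (1 / of_int k :: real)"
    using k(1) by (simp add: field_simps power2_eq_square)
  moreover have "1 / of_int k < (2 / of_int k :: real)" using k(1) by (simp add: divide_strict_right_mono)
  ultimately have 2: "\<bar>\<omega> - real_of_rat \<rho>\<bar> < e" using k(3) ke \<rho>(2) by linarith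
  have "1 / of_int k + \<bar>of_int k * \<omega> - of_int h\<bar> < e" using 1 ke by simp
  with \<rho>(1) 2 show ?thesis by (rule that)
qed

lemma rationals_near_neq_bot: "filtercomap real_of_rat (nhds \<omega>) \<noteq> bot"
proof (rule filtercomap_neq_bot)
  fix P assume "eventually P (nhds \<omega>)"
  then obtain e where e: "e > 0" "\<And>t. dist t \<omega> < e \<Longrightarrow> P t" unfolding eventually_nhds_metric by blast
  obtain \<rho> where "\<omega> < real_of_rat \<rho>" "real_of_rat \<rho> < \<omega> + e" using of_rat_dense[of \<omega> "\<omega> + e"] e by auto
  then show "\<exists>\<rho>. P (real_of_rat \<rho>)" using e(2)[of "real_of_rat \<rho>"] by (auto simp: dist_real_def)
qed

context monotone_potential
begin

text \<open>The one-sided comparisons need \<open>p < P\<close> and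
  \<open>\<epsilon> \<le> 2\<close>. For a defect of at least 1 the crude bound on both barriers
  suffices; for \<open>p = P\<close> and a smaller defect integrality forces \<open>Q = q\<close>.
  The factor 22 dominates 8, 20 and, relative to \<open>r\<^sup>2\<close>, also
  \<open>r + 1\<close>.\<close>

lemma barrier_difference_le:
  assumes p: "p \<ge> 1" "coprime p q" and P: "P \<ge> 1" "coprime P Q" and pP: "p \<le> P"
    and R: "\<bar>of_int q / of_int p\<bar> \<le> R" "\<bar>of_int Q / of_int P\<bar> \<le> R"
    and L: "lip (R + 3 + 16 * real r) L"
  shows "\<bar>(pn p q \<xi> - mn p q) - (pn P Q \<xi> - mn P Q)\<bar>
    \<le> 22 * (real r)\<^sup>2 * L * (1 / of_int p + \<bar>of_int p * (of_int Q / of_int P) - of_int q\<bar>)"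
    (is "\<bar>?b - ?B\<bar> \<le> ?C * ?\<epsilon>")
proof -
  have L0: "L \<ge> 0" using L by (simp add: lipschitz_windows_def)
  have C0: "?C \<ge> 0" using L0 by simp
  have \<epsilon>0: "?\<epsilon> \<ge> 0" using p by simp
  show ?thesis
  proof (cases "\<bar>of_int p * (of_int Q / of_int P) - of_int q\<bar> \<ge> (1 :: real)")
    case True
    have "lip (R + 2 + 1) L" by (rule lipschitz_windows_antimono[OF L]) simp
    then have "?b \<le> (real r + 1) * L" "?B \<le> (real r + 1) * L"
      using barrier_bounded p P R by blast+
    moreover have "?b \<ge> 0" "?B \<ge> 0" using min_le_pinned p P by simp_all
    moreover have "(real r + 1) * L \<le> ?C * 1"
    proof -
      have "1 \<le> real r" "1 \<le> (real r)\<^sup>2" using r by simp_all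
      moreover have "real r \<le> (real r)\<^sup>2" using r by (intro self_le_power) auto
      ultimately have "real r + 1 \<le> 22 * (real r)\<^sup>2" by linarith
      then show ?thesis using L0 by (simp add: mult_right_mono)
    qed
    moreover have "?C * 1 \<le> ?C * ?\<epsilon>"
    proof (rule mult_left_mono[OF _ C0])
      show "1 \<le> ?\<epsilon>" using True p by (intro add_increasing) auto
    qed
    ultimately show ?thesis by linarith
  next
    case False
    show ?thesis
    proof (cases "p = P")
      case True
      then have "\<bar>of_int (Q - q)\<bar> < (1 :: real)" using False p by simp
      then have "Q = q" by linarith
      then show ?thesis using True mult_nonneg_nonneg[OF C0 \<epsilon>0] by simp
    next
      case neq: False
      then have lt: "p < P" using pP by simp
      have "1 / of_int p \<le> (1 :: real)" using p by simp
      then have \<epsilon>2: "?\<epsilon> \<le> 2" using False by linarith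
      have "?b \<le> ?B + 8 * (real r)\<^sup>2 * L * ?\<epsilon>"
        by (rule barrier_le_longer_period[OF p lt P(2) R(2) refl \<epsilon>2 lipschitz_windows_antimono[OF L]]) simp
      moreover have "?B \<le> ?b + 20 * (real r)\<^sup>2 * L * ?\<epsilon>"
        by (rule barrier_le_shorter_period[OF p lt P(2) R refl \<epsilon>2 lipschitz_windows_antimono[OF L]]) simp
      moreover have "8 * (real r)\<^sup>2 * L * ?\<epsilon> \<le> ?C * ?\<epsilon>" "20 * (real r)\<^sup>2 * L * ?\<epsilon> \<le> ?C * ?\<epsilon>"
        using L0 by (intro mult_right_mono[OF _ \<epsilon>0] mult_right_mono; simp)+
      ultimately show ?thesis by (intro abs_leI) linarith+
    qed
  qed
qed

text \<open>The second rational may have the smaller denominator. Exchanging the roles then at most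
  doubles the error: \<open>p * Q - P * q\<close> is a nonzero integer, so
  \<open>1 / P \<le> ?d\<close>, and the exchanged defect is \<open>?d\<close> scaled by
  \<open>P / p < 1\<close>.\<close>

lemma barrier_difference_le':
  assumes p: "p \<ge> 1" "coprime p q" and P: "P \<ge> 1" "coprime P Q"
    and R: "\<bar>of_int q / of_int p\<bar> \<le> R" "\<bar>of_int Q / of_int P\<bar> \<le> R"
    and L: "lip (R + 3 + 16 * real r) L"
  shows "\<bar>(pn p q \<xi> - mn p q) - (pn P Q \<xi> - mn P Q)\<bar>
    \<le> 44 * (real r)\<^sup>2 * L * (1 / of_int p + \<bar>of_int p * (of_int Q / of_int P) - of_int q\<bar>)"
    (is "\<bar>?b - ?B\<bar> \<le> _ * ?\<epsilon>")
proof -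
  have L0: "L \<ge> 0" using L by (simp add: lipschitz_windows_def)
  let ?C = "22 * (real r)\<^sup>2 * L"
  have C0: "?C \<ge> 0" using L0 by simp
  have \<epsilon>0: "?\<epsilon> \<ge> 0" using p by simp
  have "\<bar>?b - ?B\<bar> \<le> ?C * (2 * ?\<epsilon>)"
  proof (cases "p \<le> P")
    case True
    have "\<bar>?b - ?B\<bar> \<le> ?C * ?\<epsilon>" by (rule barrier_difference_le[OF p P True R L])
    then show ?thesis using mult_nonneg_nonneg[OF C0 \<epsilon>0] by linarith
  next
    case False
    let ?d = "\<bar>of_int p * (of_int Q / of_int P) - of_int q :: real\<bar>"
    have "p * Q \<noteq> P * q"
    proof
      assume "p * Q = P * q"
      then have "p dvd P" using p(2) by (metis coprime_dvd_mult_left_iff dvd_triv_left)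
      then show False using False P zdvd_imp_le by fastforce
    qed
    then have "1 \<le> \<bar>of_int (p * Q - P * q) :: real\<bar>" by linarith
    also have "\<dots> = of_int P * ?d"
    proof -
      have "of_int (p * Q - P * q) = of_int P * (of_int p * (of_int Q / of_int P) - of_int q :: real)"
        using P by (simp add: field_simps)
      then show ?thesis using P by (simp add: abs_mult)
    qed
    finally have 1: "1 / of_int P \<le> ?d" using P by (simp add: divide_le_eq mult.commute)
    have "\<bar>of_int P * (of_int q / of_int p) - of_int Q\<bar> = of_int P / of_int p * ?d"
    proof -
      have "of_int P * (of_int q / of_int p) - of_int Q
          = - (of_int P / of_int p * (of_int p * (of_int Q / of_int P) - of_int q) :: real)"
        using p P by (simp add: field_simps)
      then show ?thesis using p P by (simp add: abs_mult)
    qed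
    also have "\<dots> \<le> 1 * ?d" using False p by (intro mult_right_mono) auto
    finally have 2: "\<bar>of_int P * (of_int q / of_int p) - of_int Q\<bar> \<le> ?d" by simp
    have "\<bar>?B - ?b\<bar> \<le> ?C * (1 / of_int P + \<bar>of_int P * (of_int q / of_int p) - of_int Q\<bar>)"
      by (rule barrier_difference_le[OF P p _ R(2,1) L]) (use False in simp)
    also have "\<dots> \<le> ?C * (2 * ?\<epsilon>)"
    proof (rule mult_left_mono[OF _ C0])
      show "1 / of_int P + \<bar>of_int P * (of_int q / of_int p) - of_int Q\<bar> \<le> 2 * ?\<epsilon>"
        by (rule order_trans[OF add_mono[OF 1 2]]) (use p in simp)
    qed
    finally show ?thesis by (simp add: abs_minus_commute)
  qed
  moreover have "?C * (2 * t) = 44 * (real r)\<^sup>2 * L * t" for t by simp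
  ultimately show ?thesis by (simp only:)
qed

section \<open>Passage to irrational rotation numbers\<close>

abbreviation "PB \<equiv> peierls_barrier_rat S"

lemma barrier_rat_lipschitz:
  assumes R: "R \<ge> 0"
  obtains C where "C > 0" "\<And>\<rho> \<sigma> q p \<xi>. quotient_of \<rho> = (q, p) \<Longrightarrow> \<bar>real_of_rat \<rho>\<bar> \<le> R \<Longrightarrow>
    \<bar>real_of_rat \<sigma>\<bar> \<le> R \<Longrightarrow>
    \<bar>PB \<rho> \<xi> - PB \<sigma> \<xi>\<bar> \<le> C * (1 / of_int p + \<bar>of_int p * real_of_rat \<sigma> - of_int q\<bar>)"
proof -
  obtain L where L: "lip (R + 3 + 16 * real r) L"
    by (rule lipschitz_windows_exists[of "R + 3 + 16 * real r"]) (use R in auto)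
  have L0: "L \<ge> 0" using L by (simp add: lipschitz_windows_def)
  \<comment> \<open>The added 1 keeps \<open>C\<close> positive when \<open>L = 0\<close>.\<close>
  define C where "C = 44 * (real r)\<^sup>2 * L + 1"
  show ?thesis
  proof (rule that[of C])
    show "C > 0" using L0 by (simp add: C_def add_nonneg_pos)
    fix \<rho> \<sigma> q p \<xi>
    assume \<rho>: "quotient_of \<rho> = (q, p)" and le: "\<bar>real_of_rat \<rho>\<bar> \<le> R" "\<bar>real_of_rat \<sigma>\<bar> \<le> R"
    obtain Q P where \<sigma>: "quotient_of \<sigma> = (Q, P)" by fastforce
    have p: "p \<ge> 1" "coprime p q" and P: "P \<ge> 1" "coprime P Q"
      using quotient_of_denom_pos[OF \<rho>] quotient_of_denom_pos[OF \<sigma>]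
        quotient_of_coprime[OF \<rho>] quotient_of_coprime[OF \<sigma>] by (simp_all add: coprime_commute)
    let ?\<epsilon> = "1 / of_int p + \<bar>of_int p * real_of_rat \<sigma> - of_int q\<bar>"
    have "\<bar>PB \<rho> \<xi> - PB \<sigma> \<xi>\<bar> = \<bar>(pn p q \<xi> - mn p q) - (pn P Q \<xi> - mn P Q)\<bar>"
      using \<rho> \<sigma> by (simp add: peierls_barrier_rat_def pinned_action_def min_action_def)
    also have "\<dots> \<le> 44 * (real r)\<^sup>2 * L * ?\<epsilon>"
      unfolding real_of_rat_quotient_of[OF \<sigma>]
      by (rule barrier_difference_le'[OF p P _ _ L])
        (use le real_of_rat_quotient_of[OF \<rho>] real_of_rat_quotient_of[OF \<sigma>] in simp_all)
    also have "\<dots> \<le> C * ?\<epsilon>" using p by (intro mult_right_mono) (auto simp: C_def)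
    finally show "\<bar>PB \<rho> \<xi> - PB \<sigma> \<xi>\<bar> \<le> C * ?\<epsilon>" .
  qed
qed

text \<open>With one good approximation \<open>\<rho>\<close> fixed, the bound is continuous in the
  value of \<open>\<sigma>\<close> and ignores its denominator. Hence all \<open>\<sigma>\<close>
  near \<open>\<omega>\<close> have barriers close to that of \<open>\<rho>\<close>, and the Cauchy
  criterion holds.\<close>

lemma barrier_tendsto:
  assumes C: "C > 0" "\<And>\<rho> \<sigma> q p. quotient_of \<rho> = (q, p) \<Longrightarrow> \<bar>real_of_rat \<rho>\<bar> \<le> R \<Longrightarrow>
      \<bar>real_of_rat \<sigma>\<bar> \<le> R \<Longrightarrow>
      \<bar>PB \<rho> \<xi> - PB \<sigma> \<xi>\<bar> \<le> C * (1 / of_int p + \<bar>of_int p * real_of_rat \<sigma> - of_int q\<bar>)"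
    and \<omega>: "\<omega> \<notin> \<rat>" "\<bar>\<omega>\<bar> < R"
  shows "((\<lambda>\<rho>. PB \<rho> \<xi>) \<longlongrightarrow> peierls_barrier S \<omega> \<xi>) (filtercomap real_of_rat (nhds \<omega>))"
proof -
  let ?F = "filtercomap real_of_rat (nhds \<omega>)"
  have id: "(real_of_rat \<longlongrightarrow> \<omega>) ?F" by (rule filterlim_filtercomap)
  have ball: "eventually (\<lambda>\<sigma>. \<bar>real_of_rat \<sigma>\<bar> < R) ?F"
    using order_tendstoD(2)[OF tendsto_rabs[OF id] \<omega>(2)] .
  have "cauchy_filter (filtermap (\<lambda>\<rho>. PB \<rho> \<xi>) ?F)"
    unfolding cauchy_filter_metric_filtermap
  proof (intro allI impI)
    fix e :: real assume e: "e > 0"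
    have "min (e / (2 * C)) (R - \<bar>\<omega>\<bar>) > 0" using e C(1) \<omega>(2) by simp
    from irrational_rational_approx[OF \<omega>(1) this]
    obtain \<rho> q p where \<rho>: "quotient_of \<rho> = (q, p)" "\<bar>\<omega> - real_of_rat \<rho>\<bar> < R - \<bar>\<omega>\<bar>"
      "1 / of_int p + \<bar>of_int p * \<omega> - of_int q\<bar> < e / (2 * C)"
      by (metis min_less_iff_conj)
    have R\<rho>: "\<bar>real_of_rat \<rho>\<bar> \<le> R" using \<rho>(2) by linarith
    have "((\<lambda>\<sigma>. 1 / of_int p + \<bar>of_int p * real_of_rat \<sigma> - of_int q\<bar>)
        \<longlongrightarrow> 1 / of_int p + \<bar>of_int p * \<omega> - of_int q\<bar>) ?F"
      by (intro tendsto_intros id)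
    then have ev: "eventually (\<lambda>\<sigma>. 1 / of_int p + \<bar>of_int p * real_of_rat \<sigma> - of_int q\<bar> < e / (2 * C)) ?F"
      using order_tendstoD(2) \<rho>(3) by blast
    have half: "\<bar>PB \<rho> \<xi> - PB \<sigma> \<xi>\<bar> < e / 2"
      if "\<bar>real_of_rat \<sigma>\<bar> < R" "1 / of_int p + \<bar>of_int p * real_of_rat \<sigma> - of_int q\<bar> < e / (2 * C)" for \<sigma>
    proof -
      have "\<bar>PB \<rho> \<xi> - PB \<sigma> \<xi>\<bar> \<le> C * (1 / of_int p + \<bar>of_int p * real_of_rat \<sigma> - of_int q\<bar>)"
        using C(2)[OF \<rho>(1) R\<rho>] that(1) by simp
      also have "\<dots> < C * (e / (2 * C))" using that(2) C(1) by (rule mult_strict_left_mono)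
      finally show ?thesis using C(1) by simp
    qed
    show "\<exists>P. eventually P ?F \<and> (\<forall>x y. P x \<and> P y \<longrightarrow> dist (PB x \<xi>) (PB y \<xi>) < e)"
    proof (intro exI conjI allI impI)
      show "eventually (\<lambda>\<sigma>. \<bar>PB \<rho> \<xi> - PB \<sigma> \<xi>\<bar> < e / 2) ?F"
        using ball ev by eventually_elim (rule half)
    next
      fix x y assume "\<bar>PB \<rho> \<xi> - PB x \<xi>\<bar> < e / 2 \<and> \<bar>PB \<rho> \<xi> - PB y \<xi>\<bar> < e / 2"
      then show "dist (PB x \<xi>) (PB y \<xi>) < e"
        using dist_triangle_half_r[of "PB \<rho> \<xi>" "PB x \<xi>" e "PB y \<xi>"] by (simp add: dist_real_def)
    qed
  qed
  moreover have "filtermap (\<lambda>\<rho>. PB \<rho> \<xi>) ?F \<noteq> bot"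
    using rationals_near_neq_bot by (simp add: filtermap_bot_iff)
  moreover have "complete (UNIV :: real set)" by (rule complete_UNIV)
  ultimately obtain l where l: "((\<lambda>\<rho>. PB \<rho> \<xi>) \<longlongrightarrow> l) ?F"
    unfolding complete_uniform filterlim_def by force
  have "Lim ?F (\<lambda>\<rho>. PB \<rho> \<xi>) = l" by (rule tendsto_Lim[OF rationals_near_neq_bot l])
  then show ?thesis using l \<omega>(1) by (simp add: peierls_barrier_def)
qed

lemma barrier_rational_distance:
  assumes C: "C > 0" "\<And>\<rho> \<sigma> q p. quotient_of \<rho> = (q, p) \<Longrightarrow> \<bar>real_of_rat \<rho>\<bar> \<le> R \<Longrightarrow>
      \<bar>real_of_rat \<sigma>\<bar> \<le> R \<Longrightarrow>
      \<bar>PB \<rho> \<xi> - PB \<sigma> \<xi>\<bar> \<le> C * (1 / of_int p + \<bar>of_int p * real_of_rat \<sigma> - of_int q\<bar>)"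
    and \<omega>: "\<bar>\<omega>\<bar> < R" and \<rho>: "quotient_of \<rho> = (q, p)" "\<bar>real_of_rat \<rho>\<bar> \<le> R"
  shows "\<bar>PB \<rho> \<xi> - peierls_barrier S \<omega> \<xi>\<bar> \<le> C * (1 / of_int p + \<bar>of_int p * \<omega> - of_int q\<bar>)"
proof (cases "\<omega> \<in> \<rat>")
  case True
  then obtain \<sigma> where \<sigma>: "\<omega> = real_of_rat \<sigma>" by (auto simp: Rats_def)
  then have "(THE \<rho>. real_of_rat \<rho> = \<omega>) = \<sigma>" by (intro the_equality) auto
  then have "peierls_barrier S \<omega> \<xi> = PB \<sigma> \<xi>" using True by (simp add: peierls_barrier_def)
  then show ?thesis using C(2)[OF \<rho>, of \<sigma>] \<omega> \<sigma> by simp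
next
  case False
  let ?F = "filtercomap real_of_rat (nhds \<omega>)"
  have id: "(real_of_rat \<longlongrightarrow> \<omega>) ?F" by (rule filterlim_filtercomap)
  show ?thesis
  proof (rule tendsto_le[OF rationals_near_neq_bot])
    show "((\<lambda>\<sigma>. \<bar>PB \<rho> \<xi> - PB \<sigma> \<xi>\<bar>) \<longlongrightarrow> \<bar>PB \<rho> \<xi> - peierls_barrier S \<omega> \<xi>\<bar>) ?F"
      by (intro tendsto_intros barrier_tendsto[OF C False \<omega>])
    show "((\<lambda>\<sigma>. C * (1 / of_int p + \<bar>of_int p * real_of_rat \<sigma> - of_int q\<bar>))
        \<longlongrightarrow> C * (1 / of_int p + \<bar>of_int p * \<omega> - of_int q\<bar>)) ?F"
      by (intro tendsto_intros id)
    have "eventually (\<lambda>\<sigma>. \<bar>real_of_rat \<sigma>\<bar> < R) ?F"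
      using order_tendstoD(2)[OF tendsto_rabs[OF id] \<omega>] .
    then show "eventually (\<lambda>\<sigma>. \<bar>PB \<rho> \<xi> - PB \<sigma> \<xi>\<bar>
        \<le> C * (1 / of_int p + \<bar>of_int p * real_of_rat \<sigma> - of_int q\<bar>)) ?F"
      by eventually_elim (use C(2)[OF \<rho>] in simp)
  qed
qed

end

section \<open>Diophantine and Dirichlet estimates\<close>

text \<open>The case of denominator 1 with the floor of \<open>\<omega>\<close>. It makes
  \<open>s powr (1 / \<tau>)\<close> at most its quotient by
  \<open>\<gamma> powr (1 / \<tau>)\<close>.\<close>

lemma diophantine_with_le_1:
  assumes "diophantine_with \<gamma> \<tau> \<omega>"
  shows "\<gamma> \<le> 1"
proof -
  have "\<gamma> / \<bar>of_int 1\<bar> powr \<tau> \<le> \<bar>of_int 1 * \<omega> - of_int \<lfloor>\<omega>\<rfloor>\<bar>"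
    using assms unfolding diophantine_with_def by (metis zero_neq_one)
  then show ?thesis by simp linarith
qed

lemma diophantine_denominator_bound:
  assumes d: "diophantine_with \<gamma> \<tau> \<omega>" and \<gamma>: "\<gamma> > 0" and \<tau>: "\<tau> \<ge> 1" and k: "k > 0"
    and s: "\<bar>of_int k * \<omega> - of_int h\<bar> \<le> 2 * s" "s > 0"
  shows "1 / of_int k \<le> 2 * (s powr (1 / \<tau>) / \<gamma> powr (1 / \<tau>))"
proof -
  have k0: "of_int k > (0 :: real)" using k by simp
  have "\<gamma> / of_int k powr \<tau> \<le> 2 * s"
    using d k s unfolding diophantine_with_def by (smt (verit) of_int_0_less_iff)
  then have "(1 / of_int k) powr \<tau> \<le> 2 * s / \<gamma>"
    using \<gamma> k0 by (simp add: powr_divide field_simps)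
  then have "((1 / of_int k) powr \<tau>) powr (1 / \<tau>) \<le> (2 * s / \<gamma>) powr (1 / \<tau>)"
    using \<tau> by (intro powr_mono2) auto
  then have "1 / of_int k \<le> (2 * s / \<gamma>) powr (1 / \<tau>)"
    using \<tau> k0 by (simp add: powr_powr)
  also have "\<dots> = 2 powr (1 / \<tau>) * (s powr (1 / \<tau>) / \<gamma> powr (1 / \<tau>))"
    using s \<gamma> by (simp add: powr_divide powr_mult)
  also have "\<dots> \<le> 2 * (s powr (1 / \<tau>) / \<gamma> powr (1 / \<tau>))"
  proof (rule mult_right_mono)
    have "2 powr (1 / \<tau>) \<le> 2 powr 1" using \<tau> by (intro powr_mono) auto
    then show "2 powr (1 / \<tau>) \<le> 2" by simp
  qed simp
  finally show ?thesis .
qed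

text \<open>With \<open>N\<close> the floor of \<open>1 / s\<close>, the inequality
  \<open>1 / s < N + 1 \<le> 2 * N\<close> gives \<open>1 / N \<le> 2 * s\<close>. The bound by 1
  keeps the fraction near \<open>\<omega>\<close>.\<close>

lemma dirichlet_sqrt:
  assumes s: "0 < s" "s \<le> (1 :: real)"
  obtains h k where "coprime h k" "0 < k" "of_int k * s \<le> 1" "\<bar>of_int k * \<omega> - of_int h\<bar> \<le> min 1 (2 * s)"
proof -
  define N where "N = nat \<lfloor>1 / s\<rfloor>"
  have "1 / s \<ge> 1" using s by simp
  then have N: "real N \<ge> 1" "real N \<le> 1 / s" "1 / s < real N + 1" by (simp_all add: N_def, linarith+)
  then obtain h k where hk: "coprime h k" "0 < k" "k \<le> int N" "\<bar>of_int k * \<omega> - of_int h\<bar> < 1 / real N"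
    using Dirichlet_approx_coprime[of N \<omega>] by (metis gr0I not_one_le_zero of_nat_0)
  have "1 / s \<le> 2 * real N" using N by linarith
  then have "1 / real N \<le> 2 * s" using s N by (simp add: field_simps)
  moreover have "1 / real N \<le> 1" using N by simp
  moreover have "of_int k * s \<le> 1"
  proof -
    have "of_int k \<le> 1 / s" using hk(3) N(2) by linarith
    then show ?thesis using s by (simp add: field_simps)
  qed
  ultimately show ?thesis using hk by (intro that[of h k] min.boundedI) linarith+
qed

theorem corollary5p4:
  fixes r :: nat and S :: "(nat \<Rightarrow> real) \<Rightarrow> real" and \<omega> :: real
  assumes "r \<ge> 1"
    and "local_potential r S"
    and "periodicity S"
    and "monotonicity r S"
    and "coercivity r S"
    and "diophantine \<omega>"
  shows "\<exists>C>0. \<forall>\<gamma> \<tau>. \<gamma> > 0 \<and> \<tau> \<ge> 1 \<and> diophantine_with \<gamma> \<tau> \<omega> \<longrightarrow>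
           (\<forall>\<xi> \<Omega>. 0 < \<bar>\<Omega> - \<omega>\<bar> \<and> \<bar>\<Omega> - \<omega>\<bar> \<le> 1 \<longrightarrow>
              \<bar>peierls_barrier S \<omega> \<xi> - peierls_barrier S \<Omega> \<xi>\<bar>
                < 5 * C / \<gamma> powr (1 / \<tau>) * \<bar>\<Omega> - \<omega>\<bar> powr (1 / (2 * \<tau>)))"
proof -
  interpret monotone_potential r S by unfold_locales (use assms in auto)
  \<comment> \<open>Both \<open>\<Omega>\<close> and the fraction \<open>\<rho>\<close> below lie
    within 1 of \<open>\<omega>\<close>. \<open>C\<close> depends on \<open>S\<close> and
    \<open>R\<close> only, and so is chosen before \<open>\<gamma>\<close> and
    \<open>\<tau>\<close>.\<close>
  define R where "R = \<bar>\<omega>\<bar> + 3"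
  have "R \<ge> 0" by (simp add: R_def)
  then obtain C where C: "C > 0" "\<And>\<rho> \<sigma> q p \<xi>. quotient_of \<rho> = (q, p) \<Longrightarrow> \<bar>real_of_rat \<rho>\<bar> \<le> R \<Longrightarrow>
      \<bar>real_of_rat \<sigma>\<bar> \<le> R \<Longrightarrow>
      \<bar>PB \<rho> \<xi> - PB \<sigma> \<xi>\<bar> \<le> C * (1 / of_int p + \<bar>of_int p * real_of_rat \<sigma> - of_int q\<bar>)"
    using barrier_rat_lipschitz by metis
  show ?thesis
  \<comment> \<open>The distances of \<open>\<rho>\<close> to \<open>\<omega>\<close> and
    \<open>\<Omega>\<close> cost \<open>4 * C * E\<close> and \<open>5 * C * E\<close>; the total
    \<open>9 * C * E\<close> lies strictly below \<open>5 * (2 * C) * E\<close>.\<close>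
  proof (intro exI[of _ "2 * C"] conjI allI impI)
    fix \<gamma> \<tau> \<xi> \<Omega> :: real
    assume "\<gamma> > 0 \<and> \<tau> \<ge> 1 \<and> diophantine_with \<gamma> \<tau> \<omega>"
    then have \<gamma>: "\<gamma> > 0" and \<tau>: "\<tau> \<ge> 1" and d: "diophantine_with \<gamma> \<tau> \<omega>" by auto
    assume "0 < \<bar>\<Omega> - \<omega>\<bar> \<and> \<bar>\<Omega> - \<omega>\<bar> \<le> 1"
    define \<Delta> where "\<Delta> = \<bar>\<Omega> - \<omega>\<bar>"
    define s where "s = sqrt \<Delta>"
    have \<Delta>: "0 < \<Delta>" "\<Delta> \<le> 1" using \<open>0 < \<bar>\<Omega> - \<omega>\<bar> \<and> \<bar>\<Omega> - \<omega>\<bar> \<le> 1\<close> by (auto simp: \<Delta>_def)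
    have s: "0 < s" "s \<le> 1" "s * s = \<Delta>" using \<Delta> by (auto simp: s_def)
    define E where "E = \<Delta> powr (1 / (2 * \<tau>)) / \<gamma> powr (1 / \<tau>)"
    have sE: "s powr (1 / \<tau>) = \<Delta> powr (1 / (2 * \<tau>))"
      using \<Delta> by (simp add: s_def powr_half_sqrt[symmetric] powr_powr)
    obtain h k where hk: "coprime h k" "0 < k" "of_int k * s \<le> 1"
      "\<bar>of_int k * \<omega> - of_int h\<bar> \<le> min 1 (2 * s)"
      using dirichlet_sqrt[OF s(1,2)] by metis
    obtain \<rho> where \<rho>: "quotient_of \<rho> = (h, k)" "real_of_rat \<rho> = of_int h / of_int k"
      using coprime_fraction[OF hk(1,2)] by blast
    have "\<bar>real_of_rat \<rho>\<bar> \<le> R"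
    proof -
      have "of_int k * (real_of_rat \<rho> - \<omega>) = of_int h - of_int k * \<omega>"
        using hk(2) \<rho>(2) by (simp add: field_simps)
      then have "of_int k * \<bar>real_of_rat \<rho> - \<omega>\<bar> = \<bar>of_int h - of_int k * \<omega>\<bar>"
        using hk(2) by (metis abs_mult abs_of_pos of_int_0_less_iff)
      also have "\<dots> \<le> 1" using hk(4) by linarith
      finally have "of_int k * \<bar>real_of_rat \<rho> - \<omega>\<bar> \<le> 1" .
      moreover have "1 * \<bar>real_of_rat \<rho> - \<omega>\<bar> \<le> of_int k * \<bar>real_of_rat \<rho> - \<omega>\<bar>"
        using hk(2) by (intro mult_right_mono) auto
      ultimately have "1 * \<bar>real_of_rat \<rho> - \<omega>\<bar> \<le> 1" by (rule order_trans[rotated])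
      then have "\<bar>real_of_rat \<rho> - \<omega>\<bar> \<le> 1" by simp
      then show ?thesis unfolding R_def by linarith
    qed
    then have dist: "\<bar>PB \<rho> \<xi> - peierls_barrier S t \<xi>\<bar> \<le> C * (1 / of_int k + \<bar>of_int k * t - of_int h\<bar>)"
      if "\<bar>t\<bar> < R" for t
      using barrier_rational_distance[OF C(1) C(2) that \<rho>(1)] by blast
    have k: "1 / of_int k \<le> 2 * E"
      using diophantine_denominator_bound[OF d \<gamma> \<tau> hk(2), of h s] hk(4) s sE by (simp add: E_def)
    have sE': "s \<le> E"
    proof -
      have "s powr 1 \<le> s powr (1 / \<tau>)" using s \<tau> by (intro powr_mono') auto
      then have "s \<le> \<Delta> powr (1 / (2 * \<tau>))" using s sE by simp
      also have "\<dots> \<le> E"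
      proof -
        have "\<gamma> powr (1 / \<tau>) \<le> 1 powr (1 / \<tau>)"
          using \<gamma> \<tau> diophantine_with_le_1[OF d] by (intro powr_mono2) auto
        then show ?thesis unfolding E_def using \<gamma>
          by (simp add: le_divide_eq mult_left_le)
      qed
      finally show ?thesis .
    qed
    have E0: "E > 0" using sE' s by linarith
    \<comment> \<open>Here the square root balances:
      \<open>k * \<Delta> = k * s * s \<le> s\<close>, the same order as the Dirichlet error
      \<open>2 * s\<close>.\<close>
    have "\<bar>of_int k * \<Omega> - of_int h\<bar> \<le> 2 * s + s"
    proof -
      have "\<bar>of_int k * \<Omega> - of_int h\<bar> \<le> \<bar>of_int k * \<omega> - of_int h\<bar> + \<bar>of_int k * (\<Omega> - \<omega>)\<bar>"
        by (simp add: algebra_simps)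
      moreover have "\<bar>of_int k * (\<Omega> - \<omega>)\<bar> = of_int k * s * s"
        using hk(2) s(3) by (simp add: abs_mult \<Delta>_def)
      moreover have "of_int k * s * s \<le> 1 * s" using hk(3) s by (intro mult_right_mono) auto
      ultimately show ?thesis using hk(4) by linarith
    qed
    then have "C * (1 / of_int k + \<bar>of_int k * \<Omega> - of_int h\<bar>) \<le> C * (5 * E)"
      using k sE' C(1) by (intro mult_left_mono) auto
    moreover have "C * (1 / of_int k + \<bar>of_int k * \<omega> - of_int h\<bar>) \<le> C * (4 * E)"
      using k sE' hk(4) C(1) by (intro mult_left_mono) auto
    moreover have "\<bar>\<omega>\<bar> < R" "\<bar>\<Omega>\<bar> < R" using \<Delta> unfolding R_def \<Delta>_def by linarith+
    note dist[OF this(1)] dist[OF this(2)]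
    ultimately have "\<bar>peierls_barrier S \<omega> \<xi> - peierls_barrier S \<Omega> \<xi>\<bar> \<le> 9 * (C * E)" by linarith
    also have "\<dots> < 10 * (C * E)" using C(1) E0 by simp
    also have "\<dots> = 5 * (2 * C) / \<gamma> powr (1 / \<tau>) * \<bar>\<Omega> - \<omega>\<bar> powr (1 / (2 * \<tau>))"
      by (simp add: E_def \<Delta>_def)
    finally show "\<bar>peierls_barrier S \<omega> \<xi> - peierls_barrier S \<Omega> \<xi>\<bar>
        < 5 * (2 * C) / \<gamma> powr (1 / \<tau>) * \<bar>\<Omega> - \<omega>\<bar> powr (1 / (2 * \<tau>))" .
  qed (use C(1) in simp)
qed

end
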